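(* There exists a noncomputable set $U\subseteq\mathbb N$ with $U\leq_T\emptyset''$ such that \[ \left(\{[B]_1: B\subseteq\mathbb N,\ B\equiv_{\mathrm{bfo}}U\},\leq_1\right)\cong(\mathbb D_{>0},\leq)\cong(\mathbb Q,\leq), \] where $\mathbb D_{>0}=\{m/2^n: m\geq 1,\ n\in\mathbb N\}$ is the set of positive dyadic rationals with the usual order and $\cong$ denotes isomorphism of partially ordered sets. In particular, the one-one degrees contained in the bounded finite-one degree of $U$, ordered by $\leq_1$, form a countable dense linear order without endpoints.
   Context: All sets are subsets of $\mathbb N=\{0,1,2,\ldots\}$; $\leq_T$ is Turing reducibility and $\emptyset''$ is the second Turing jump of the empty set. A total computable $f:\mathbb N\to\mathbb N$ is a many-one reduction from $A$ to $B$ if $x\in A\iff f(x)\in B$ for all $x$. It is a one-one reduction if it is injective, and a bounded finite-one reduction if there is a constant $k\geq1$ (depending on $f$ only) with $|f^{-1}(y)|\leq k$ for all $y$. Write $A\leq_1 B$, $A\leq_{\mathrm{bfo}}B$ if a one-one, respectively bounded finite-one, reduction from $A$ to $B$ exists; $\equiv_1$, $\equiv_{\mathrm{bfo}}$ are the induced equivalence relations. $[B]_1$ is the $\equiv_1$-class (one-one degree) of $B$; $\leq_1$ induces a partial order on one-one degrees. The bounded finite-one degree of $U$ is its $\equiv_{\mathrm{bfo}}$-class. *)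

theory Defs
  imports Complex_Main "HOL-Library.Nat_Bijection" "HOL-Library.Countable_Set"
begin

text \<open>
  Partial recursive functions relative to an oracle, given by programs so that they can be
  indexed. All programs are unary: several arguments are passed as one number through the Cantor
  pairing bijection \<^const>\<open>prod_encode\<close>.
\<close>

datatype prog =
    ZeroP
  | SuccP
  | FstP
  | SndP
  | OracleP
  | PairP prog prog
  | CompP prog prog
  | PrecP prog prog
  | MuP prog

text \<open>\<open>eval X p x y\<close>: program \<open>p\<close> with oracle \<open>X\<close> halts on input \<open>x\<close> with output \<open>y\<close>.\<close>

inductive eval :: "nat set \<Rightarrow> prog \<Rightarrow> nat \<Rightarrow> nat \<Rightarrow> bool" for X :: "nat set" where
  Zero: "eval X ZeroP x 0"
| Succ: "eval X SuccP x (Suc x)"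
| Fst: "eval X FstP x (fst (prod_decode x))"
| Snd: "eval X SndP x (snd (prod_decode x))"
| Oracle: "eval X OracleP x (if x \<in> X then 1 else 0)"
| Pair: "eval X p x a \<Longrightarrow> eval X q x b \<Longrightarrow> eval X (PairP p q) x (prod_encode (a, b))"
| Comp: "eval X q x z \<Longrightarrow> eval X p z y \<Longrightarrow> eval X (CompP p q) x y"
| Prec_0: "eval X p a y \<Longrightarrow> eval X (PrecP p q) (prod_encode (a, 0)) y"
| Prec_Suc: "eval X (PrecP p q) (prod_encode (a, n)) r \<Longrightarrow>
    eval X q (prod_encode (a, prod_encode (n, r))) y \<Longrightarrow>
    eval X (PrecP p q) (prod_encode (a, Suc n)) y"
| Mu: "eval X p (prod_encode (x, n)) 0 \<Longrightarrow>
    (\<And>m. m < n \<Longrightarrow> \<exists>k. eval X p (prod_encode (x, m)) (Suc k)) \<Longrightarrow>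
    eval X (MuP p) x n"

inductive_cases eval_ZeroE: "eval X ZeroP x y"
inductive_cases eval_SuccE: "eval X SuccP x y"
inductive_cases eval_FstE: "eval X FstP x y"
inductive_cases eval_SndE: "eval X SndP x y"
inductive_cases eval_OracleE: "eval X OracleP x y"
inductive_cases eval_PairE: "eval X (PairP p q) x y"
inductive_cases eval_CompE: "eval X (CompP p q) x y"
inductive_cases eval_PrecE: "eval X (PrecP p q) x y"
inductive_cases eval_MuE: "eval X (MuP p) x y"

lemma eval_deterministic: "eval X p x y \<Longrightarrow> eval X p x z \<Longrightarrow> y = z"
proof (induction arbitrary: z rule: eval.induct)
  case (Mu p x n)
  from Mu.prems obtain z0: "eval X p (prod_encode (x, z)) 0"
    and zlt: "\<And>m. m < z \<Longrightarrow> \<exists>k. eval X p (prod_encode (x, m)) (Suc k)"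
    by (rule eval_MuE) blast
  show ?case
  proof (cases n z rule: linorder_cases)
    case less
    then show ?thesis using zlt Mu.IH(1) by (metis nat.distinct(1))
  next
    case greater
    then show ?thesis using z0 Mu.IH(2) by (metis nat.distinct(1))
  qed simp
next
  case (Prec_0 p a y q)
  from Prec_0.prems have "eval X p a z"
    by (rule eval_PrecE) (simp_all add: prod_encode_eq)
  then show ?case by (rule Prec_0.IH)
next
  case (Prec_Suc p q a n r y)
  from Prec_Suc.prems obtain r' where r': "eval X (PrecP p q) (prod_encode (a, n)) r'"
    and z: "eval X q (prod_encode (a, prod_encode (n, r'))) z"
    by (rule eval_PrecE) (simp_all add: prod_encode_eq)
  from Prec_Suc.IH(1)[OF r'] z show ?case by (intro Prec_Suc.IH(2)) simp
next
  case (Pair p x a q b)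
  from Pair.prems show ?case
    by (rule eval_PairE) (metis Pair.IH)
next
  case (Comp q x u p y)
  from Comp.prems show ?case
    by (rule eval_CompE) (metis Comp.IH)
qed (auto elim: eval_ZeroE eval_SuccE eval_FstE eval_SndE eval_OracleE)

fun index :: "prog \<Rightarrow> nat" where
  "index ZeroP = 0"
| "index SuccP = 1"
| "index FstP = 2"
| "index SndP = 3"
| "index OracleP = 4"
| "index (PairP p q) = 5 + 4 * prod_encode (index p, index q)"
| "index (CompP p q) = 6 + 4 * prod_encode (index p, index q)"
| "index (PrecP p q) = 7 + 4 * prod_encode (index p, index q)"
| "index (MuP p) = 8 + 4 * index p"

lemma inj_index: "inj index"
proof (rule injI)
  have neq: "5 + 4 * a \<noteq> 6 + 4 * b" "5 + 4 * a \<noteq> 7 + 4 * b" "5 + 4 * a \<noteq> 8 + 4 * b"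
    "6 + 4 * a \<noteq> 7 + 4 * b" "6 + 4 * a \<noteq> 8 + 4 * b" "7 + 4 * a \<noteq> 8 + 4 * b" for a b :: nat
    by presburger+
  show "index p = index q \<Longrightarrow> p = q" for p q
    by (induction p arbitrary: q; case_tac q) (simp_all add: neq neq[symmetric])
qed

lemma surj_index: "surj index"
proof -
  have "\<exists>p. index p = e" for e
  proof (induction e rule: less_induct)
    case (less e)
    show ?case
    proof (cases "e < 5")
      case True
      then consider "e = 0" | "e = 1" | "e = 2" | "e = 3" | "e = 4" by linarith
      then show ?thesis by cases (metis index.simps)+
    next
      case False
      define k a b where "k = (e - 5) div 4"
        and "a = fst (prod_decode k)" and "b = snd (prod_decode k)"
      have k: "prod_encode (a, b) = k" "k < e"
        using False by (auto simp: a_def b_def k_def)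
      then have "a < e" "b < e"
        using le_prod_encode_1[of a b] le_prod_encode_2[of b a] by linarith+
      with less k obtain p q s where "index p = a" "index q = b" "index s = k" by metis
      with k have "index (PairP p q) = 5 + 4 * k" "index (CompP p q) = 6 + 4 * k"
        "index (PrecP p q) = 7 + 4 * k" "index (MuP s) = 8 + 4 * k"
        by auto
      moreover have "e = 5 + 4 * k \<or> e = 6 + 4 * k \<or> e = 7 + 4 * k \<or> e = 8 + 4 * k"
        using False unfolding k_def by presburger
      ultimately show ?thesis by metis
    qed
  qed
  then show ?thesis by (metis surjI)
qed

definition computable_in :: "nat set \<Rightarrow> (nat \<Rightarrow> nat) \<Rightarrow> bool" where
  "computable_in X f \<longleftrightarrow> (\<exists>p. \<forall>x. eval X p x (f x))"

definition computable :: "(nat \<Rightarrow> nat) \<Rightarrow> bool" where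
  "computable f \<longleftrightarrow> computable_in {} f"

definition char_fun :: "nat set \<Rightarrow> nat \<Rightarrow> nat" where
  "char_fun A x = (if x \<in> A then 1 else 0)"

definition computable_set :: "nat set \<Rightarrow> bool" where
  "computable_set A \<longleftrightarrow> computable (char_fun A)"

definition turing_le :: "nat set \<Rightarrow> nat set \<Rightarrow> bool"  (infix "\<le>\<^sub>T" 50) where
  "A \<le>\<^sub>T B \<longleftrightarrow> computable_in B (char_fun A)"

definition jump :: "nat set \<Rightarrow> nat set" where
  "jump X = {index p | p. \<exists>y. eval X p (index p) y}"

definition many_one_reduction :: "(nat \<Rightarrow> nat) \<Rightarrow> nat set \<Rightarrow> nat set \<Rightarrow> bool" where
  "many_one_reduction f A B \<longleftrightarrow> computable f \<and> (\<forall>x. x \<in> A \<longleftrightarrow> f x \<in> B)"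

text \<open>Finiteness is needed explicitly, as \<^const>\<open>card\<close> of an infinite set is \<open>0\<close>.\<close>

definition bounded_finite_one :: "(nat \<Rightarrow> nat) \<Rightarrow> bool" where
  "bounded_finite_one f \<longleftrightarrow> (\<exists>k\<ge>1. \<forall>y. finite (f -` {y}) \<and> card (f -` {y}) \<le> k)"

definition one_le :: "nat set \<Rightarrow> nat set \<Rightarrow> bool"  (infix "\<le>\<^sub>1" 50) where
  "A \<le>\<^sub>1 B \<longleftrightarrow> (\<exists>f. many_one_reduction f A B \<and> inj f)"

definition bfo_le :: "nat set \<Rightarrow> nat set \<Rightarrow> bool"  (infix "\<le>\<^sub>b\<^sub>f\<^sub>o" 50) where
  "A \<le>\<^sub>b\<^sub>f\<^sub>o B \<longleftrightarrow> (\<exists>f. many_one_reduction f A B \<and> bounded_finite_one f)"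

definition one_equiv :: "nat set \<Rightarrow> nat set \<Rightarrow> bool"  (infix "\<equiv>\<^sub>1" 50) where
  "A \<equiv>\<^sub>1 B \<longleftrightarrow> A \<le>\<^sub>1 B \<and> B \<le>\<^sub>1 A"

definition bfo_equiv :: "nat set \<Rightarrow> nat set \<Rightarrow> bool"  (infix "\<equiv>\<^sub>b\<^sub>f\<^sub>o" 50) where
  "A \<equiv>\<^sub>b\<^sub>f\<^sub>o B \<longleftrightarrow> A \<le>\<^sub>b\<^sub>f\<^sub>o B \<and> B \<le>\<^sub>b\<^sub>f\<^sub>o A"

definition one_degree :: "nat set \<Rightarrow> nat set set" where
  "one_degree B = {A. A \<equiv>\<^sub>1 B}"

definition one_degree_le :: "nat set set \<Rightarrow> nat set set \<Rightarrow> bool" where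
  "one_degree_le D E \<longleftrightarrow> (\<exists>A\<in>D. \<exists>B\<in>E. A \<le>\<^sub>1 B)"

definition one_degrees_in_bfo_degree :: "nat set \<Rightarrow> nat set set set" where
  "one_degrees_in_bfo_degree U = {one_degree B | B. B \<equiv>\<^sub>b\<^sub>f\<^sub>o U}"

lemma one_le_refl: "A \<le>\<^sub>1 A"
proof -
  have "eval {} (PairP FstP SndP) x x" for x
    using eval.Pair[OF eval.Fst eval.Snd, of "{}" x] by simp
  then have "many_one_reduction id A A"
    unfolding many_one_reduction_def computable_def computable_in_def by auto
  then show ?thesis unfolding one_le_def by (meson inj_on_id)
qed

lemma one_le_trans:
  assumes "A \<le>\<^sub>1 B" "B \<le>\<^sub>1 C"
  shows "A \<le>\<^sub>1 C"
proof -
  from assms obtain f g where f: "many_one_reduction f A B" "inj f"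
    and g: "many_one_reduction g B C" "inj g"
    unfolding one_le_def by blast
  then have "many_one_reduction (g \<circ> f) A C"
    unfolding many_one_reduction_def computable_def computable_in_def o_def
    by (metis eval.Comp)
  with f g show ?thesis unfolding one_le_def by (blast intro: inj_compose)
qed

lemma one_degree_le_iff: "one_degree_le (one_degree A) (one_degree B) \<longleftrightarrow> A \<le>\<^sub>1 B"
proof
  assume "one_degree_le (one_degree A) (one_degree B)"
  then obtain A' B' where "A' \<equiv>\<^sub>1 A" "A' \<le>\<^sub>1 B'" "B' \<equiv>\<^sub>1 B"
    unfolding one_degree_le_def one_degree_def by blast
  then show "A \<le>\<^sub>1 B" unfolding one_equiv_def by (meson one_le_trans)
next
  assume "A \<le>\<^sub>1 B"
  moreover have "A \<in> one_degree A" "B \<in> one_degree B"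
    unfolding one_degree_def one_equiv_def by (simp_all add: one_le_refl)
  ultimately show "one_degree_le (one_degree A) (one_degree B)"
    unfolding one_degree_le_def by blast
qed

definition order_isomorphic ::
  "'a set \<Rightarrow> ('a \<Rightarrow> 'a \<Rightarrow> bool) \<Rightarrow> 'b set \<Rightarrow> ('b \<Rightarrow> 'b \<Rightarrow> bool) \<Rightarrow> bool" where
  "order_isomorphic A leA B leB \<longleftrightarrow>
    (\<exists>h. bij_betw h A B \<and> (\<forall>x\<in>A. \<forall>y\<in>A. leA x y \<longleftrightarrow> leB (h x) (h y)))"

definition countable_dense_linear_order_without_endpoints ::
  "'a set \<Rightarrow> ('a \<Rightarrow> 'a \<Rightarrow> bool) \<Rightarrow> bool" where
  "countable_dense_linear_order_without_endpoints A le \<longleftrightarrow>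
    A \<noteq> {} \<and> countable A \<and> linear_order_on A (relation_of le A) \<and>
    (\<forall>x\<in>A. \<forall>y\<in>A. le x y \<and> x \<noteq> y \<longrightarrow>
      (\<exists>z\<in>A. le x z \<and> x \<noteq> z \<and> le z y \<and> z \<noteq> y)) \<and>
    (\<forall>x\<in>A. \<exists>y\<in>A. le y x \<and> y \<noteq> x) \<and>
    (\<forall>x\<in>A. \<exists>y\<in>A. le x y \<and> x \<noteq> y)"

definition positive_dyadics :: "rat set" where
  "positive_dyadics = {of_nat m / 2 ^ n | m n. m \<ge> 1}"

end

theory Submission
  imports Defs
begin

text \<open>
  The set \<open>U\<close> is built by forcing with computable conditions. A condition leaves a computable family
  of finite blocks undecided and decides every other number computably; \<open>U\<close> is constant on each
  block. In passing from stage \<open>t\<close> to stage \<open>t + 1\<close> the blocks are merged in pairs, so that they have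
  \<open>2\<^sup>t\<close> elements at stage \<open>t\<close>, and some blocks may be decided. Given a computable \<open>f\<close>, one can either
  decide finitely many blocks so that \<open>f\<close> does not reduce \<open>U\<close> to itself, or \<open>f\<close> preserves all
  blocks. If \<open>f\<close> is bounded finite-one, then infinitely many blocks attain the largest recurring
  number of preimages, and keeping only such blocks makes this number a constant \<open>v\<close>.

  If \<open>f\<close> reduces \<open>B\<close> to \<open>U\<close> as half of a bounded finite-one equivalence, then \<open>B\<close> is thus determined up
  to one-one equivalence by the dyadic number \<open>v / 2\<^sup>t\<close>, the number of elements of \<open>B\<close> per undecided
  element of \<open>U\<close>. By rigidity and counting, a larger value does not reduce to a smaller one. The
  decided part of \<open>U\<close> contains an infinite computable set, and so does the decided part of its
  complement; otherwise finite differences would change the one-one degree.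

  The extension relation between (indices of) conditions is decidable in \<open>\<emptyset>''\<close>, because it is
  formulated with Skolem functions given by indices. So a least-number search produces \<open>U\<close>.
\<close>

section \<open>Closure properties of relative computability\<close>

abbreviation pfst :: "nat \<Rightarrow> nat" where "pfst z \<equiv> fst (prod_decode z)"
abbreviation psnd :: "nat \<Rightarrow> nat" where "psnd z \<equiv> snd (prod_decode z)"

lemma eval_PrecP:
  assumes "eval X p a (f 0)"
    and "\<And>n. eval X q (prod_encode (a, prod_encode (n, f n))) (f (Suc n))"
  shows "eval X (PrecP p q) (prod_encode (a, n)) (f n)"
proof (induction n)
  case 0
  show ?case by (rule eval.Prec_0[OF assms(1)])
next
  case (Suc n)
  show ?case by (rule eval.Prec_Suc[OF Suc assms(2)])
qed

text \<open>Precomposing a program with \<open>const_prog n\<close> hard-wires the input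
  \<open>n\<close>. This does the work of an s-m-n theorem when halting questions are built.\<close>

primrec const_prog :: "nat \<Rightarrow> prog" where
  "const_prog 0 = ZeroP"
| "const_prog (Suc n) = CompP SuccP (const_prog n)"

lemma eval_const_prog: "eval X (const_prog n) x n"
proof (induction n)
  case 0
  show ?case by (simp add: eval.Zero)
next
  case (Suc n)
  show ?case using eval.Comp[OF Suc eval.Succ] by simp
qed

lemma computable_in_const: "computable_in X (\<lambda>x. c)"
  unfolding computable_in_def using eval_const_prog by blast

lemma computable_in_comp:
  "computable_in X f \<Longrightarrow> computable_in X g \<Longrightarrow> computable_in X (\<lambda>x. f (g x))"
  unfolding computable_in_def by (blast intro: eval.Comp)

lemma computable_in_id: "computable_in X (\<lambda>x. x)"
proof -
  have "eval X (PairP FstP SndP) x x" for x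
    using eval.Pair[OF eval.Fst eval.Snd, of X x] by simp
  then show ?thesis unfolding computable_in_def by blast
qed

lemma computable_in_Suc: "computable_in X f \<Longrightarrow> computable_in X (\<lambda>x. Suc (f x))"
  unfolding computable_in_def by (blast intro: eval.Comp eval.Succ)

lemma computable_in_pfst: "computable_in X f \<Longrightarrow> computable_in X (\<lambda>x. pfst (f x))"
  unfolding computable_in_def by (blast intro: eval.Comp eval.Fst)

lemma computable_in_psnd: "computable_in X f \<Longrightarrow> computable_in X (\<lambda>x. psnd (f x))"
  unfolding computable_in_def by (blast intro: eval.Comp eval.Snd)

lemma computable_in_prod_encode:
  "computable_in X f \<Longrightarrow> computable_in X g \<Longrightarrow> computable_in X (\<lambda>x. prod_encode (f x, g x))"
  unfolding computable_in_def by (blast intro: eval.Pair)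

lemma computable_in_oracle: "computable_in X (char_fun X)"
  unfolding computable_in_def char_fun_def using eval.Oracle by blast

text \<open>Programs are unary, so a curried function is called computable when its version on coded
  pairs is.\<close>

lemma computable_in_comp2:
  assumes "computable_in X (\<lambda>z. F (pfst z) (psnd z))" "computable_in X f" "computable_in X g"
  shows "computable_in X (\<lambda>x. F (f x) (g x))"
  using computable_in_comp[OF assms(1) computable_in_prod_encode[OF assms(2,3)]] by simp

lemma computable_in_comp3:
  assumes "computable_in X (\<lambda>z. F (pfst z) (pfst (psnd z)) (psnd (psnd z)))"
    "computable_in X f" "computable_in X g" "computable_in X h"
  shows "computable_in X (\<lambda>x. F (f x) (g x) (h x))"
  using computable_in_comp[OF assms(1)
      computable_in_prod_encode[OF assms(2) computable_in_prod_encode[OF assms(3,4)]]]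
  by simp

lemma computable_in_rec_nat:
  assumes f: "computable_in X f"
    and g: "computable_in X (\<lambda>z. g (pfst z) (pfst (psnd z)) (psnd (psnd z)))"
    and n: "computable_in X n"
  shows "computable_in X (\<lambda>x. rec_nat (f x) (g x) (n x))"
proof -
  obtain p q where p: "\<And>x. eval X p x (f x)"
    and q: "\<And>z. eval X q z (g (pfst z) (pfst (psnd z)) (psnd (psnd z)))"
    using f g unfolding computable_in_def by metis
  have "eval X (PrecP p q) (prod_encode (a, k)) (rec_nat (f a) (g a) k)" for a k
  proof (rule eval_PrecP)
    show "eval X p a (rec_nat (f a) (g a) 0)" using p[of a] by simp
    show "eval X q (prod_encode (a, prod_encode (n, rec_nat (f a) (g a) n)))
        (rec_nat (f a) (g a) (Suc n))" for n
      using q[of "prod_encode (a, prod_encode (n, rec_nat (f a) (g a) n))"] by simp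
  qed
  then have "eval X (PrecP p q) (prod_encode (pfst z, psnd z))
      (rec_nat (f (pfst z)) (g (pfst z)) (psnd z))" for z .
  then have "eval X (PrecP p q) z (rec_nat (f (pfst z)) (g (pfst z)) (psnd z))" for z
    by simp
  then have "computable_in X (\<lambda>z. rec_nat (f (pfst z)) (g (pfst z)) (psnd z))"
    unfolding computable_in_def by blast
  from computable_in_comp2[OF this computable_in_id n] show ?thesis .
qed

lemmas computable_basic_intros = computable_in_const computable_in_id computable_in_Suc
  computable_in_pfst computable_in_psnd computable_in_prod_encode computable_in_rec_nat

lemma computable_in_add:
  assumes "computable_in X f" "computable_in X g"
  shows "computable_in X (\<lambda>x. f x + g x)"
proof -
  have "rec_nat a (\<lambda>_ r. Suc r) b = a + b" for a b by (induction b) auto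
  moreover have "computable_in X (\<lambda>x. rec_nat (f x) (\<lambda>_ r. Suc r) (g x))"
    by (intro computable_basic_intros assms)
  ultimately show ?thesis by simp
qed

lemma computable_in_mult:
  assumes "computable_in X f" "computable_in X g"
  shows "computable_in X (\<lambda>x. f x * g x)"
proof -
  have "rec_nat 0 (\<lambda>_ r. r + a) b = a * b" for a b :: nat by (induction b) auto
  moreover have "computable_in X (\<lambda>x. rec_nat 0 (\<lambda>_ r. r + f x) (g x))"
    by (intro computable_basic_intros computable_in_add computable_in_comp[OF assms(1)] assms)
  ultimately show ?thesis by simp
qed

lemma computable_in_diff:
  assumes "computable_in X f" "computable_in X g"
  shows "computable_in X (\<lambda>x. f x - g x)"
proof -
  have "rec_nat 0 (\<lambda>n _. n) b = b - 1" for b by (induction b) auto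
  moreover have "computable_in X (\<lambda>b. rec_nat 0 (\<lambda>n _. n) b)"
    by (intro computable_basic_intros)
  ultimately have pred: "computable_in X (\<lambda>b. b - 1)" by simp
  have "rec_nat a (\<lambda>_ r. r - 1) b = a - b" for a b :: nat by (induction b) auto
  moreover have "computable_in X (\<lambda>x. rec_nat (f x) (\<lambda>_ r. r - 1) (g x))"
    by (intro computable_basic_intros computable_in_comp[OF pred] assms)
  ultimately show ?thesis by simp
qed

lemma computable_in_sum:
  assumes "computable_in X g" "computable_in X (\<lambda>z. F (pfst z) (psnd z))"
  shows "computable_in X (\<lambda>x. \<Sum>n<g x. F x n)"
proof -
  have "rec_nat 0 (\<lambda>n r. r + F x n) b = (\<Sum>n<b. F x n)" for x b by (induction b) auto
  moreover have "computable_in X (\<lambda>x. rec_nat 0 (\<lambda>n r. r + F x n) (g x))"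
    by (intro computable_basic_intros computable_in_add computable_in_comp2[OF assms(2)] assms(1))
  ultimately show ?thesis by simp
qed

section \<open>Decidable predicates, bounded quantifiers and unbounded search\<close>

definition decidable_in :: "nat set \<Rightarrow> (nat \<Rightarrow> bool) \<Rightarrow> bool" where
  "decidable_in X P \<longleftrightarrow> computable_in X (\<lambda>x. of_bool (P x))"

lemma decidable_in_comp:
  "decidable_in X P \<Longrightarrow> computable_in X f \<Longrightarrow> decidable_in X (\<lambda>x. P (f x))"
  unfolding decidable_in_def by (rule computable_in_comp)

lemma decidable_in_comp2:
  "decidable_in X (\<lambda>z. P (pfst z) (psnd z)) \<Longrightarrow> computable_in X f \<Longrightarrow> computable_in X g \<Longrightarrow>
    decidable_in X (\<lambda>x. P (f x) (g x))"
  unfolding decidable_in_def by (rule computable_in_comp2)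

lemma decidable_in_comp3:
  "decidable_in X (\<lambda>z. P (pfst z) (pfst (psnd z)) (psnd (psnd z))) \<Longrightarrow>
    computable_in X f \<Longrightarrow> computable_in X g \<Longrightarrow> computable_in X h \<Longrightarrow>
    decidable_in X (\<lambda>x. P (f x) (g x) (h x))"
  unfolding decidable_in_def by (rule computable_in_comp3)

lemma decidable_in_const: "decidable_in X (\<lambda>x. b)"
  unfolding decidable_in_def by (rule computable_in_const)

lemma decidable_in_not:
  assumes "decidable_in X P"
  shows "decidable_in X (\<lambda>x. \<not> P x)"
proof -
  have "computable_in X (\<lambda>x. 1 - of_bool (P x))"
    by (intro computable_in_diff computable_in_const assms[unfolded decidable_in_def])
  moreover have "(\<lambda>x. 1 - of_bool (P x) :: nat) = (\<lambda>x. of_bool (\<not> P x))" by auto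
  ultimately show ?thesis unfolding decidable_in_def by simp
qed

lemma decidable_in_conj:
  assumes "decidable_in X P" "decidable_in X Q"
  shows "decidable_in X (\<lambda>x. P x \<and> Q x)"
proof -
  have "computable_in X (\<lambda>x. of_bool (P x) * of_bool (Q x))"
    by (intro computable_in_mult assms[unfolded decidable_in_def])
  then show ?thesis unfolding decidable_in_def of_bool_conj .
qed

lemma decidable_in_disj:
  assumes "decidable_in X P" "decidable_in X Q"
  shows "decidable_in X (\<lambda>x. P x \<or> Q x)"
  using decidable_in_not[OF decidable_in_conj[OF assms[THEN decidable_in_not]]] by simp

lemma decidable_in_imp:
  assumes "decidable_in X P" "decidable_in X Q"
  shows "decidable_in X (\<lambda>x. P x \<longrightarrow> Q x)"
  using decidable_in_disj[OF decidable_in_not[OF assms(1)] assms(2)] by (simp only: imp_conv_disj)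

lemma decidable_in_le:
  assumes "computable_in X f" "computable_in X g"
  shows "decidable_in X (\<lambda>x. f x \<le> g x)"
proof -
  have "computable_in X (\<lambda>x. 1 - (f x - g x))"
    by (intro computable_in_diff computable_in_const assms)
  moreover have "(\<lambda>x. 1 - (f x - g x)) = (\<lambda>x. of_bool (f x \<le> g x))" by auto
  ultimately show ?thesis unfolding decidable_in_def by simp
qed

lemma decidable_in_less:
  assumes "computable_in X f" "computable_in X g"
  shows "decidable_in X (\<lambda>x. f x < g x)"
  using decidable_in_not[OF decidable_in_le[OF assms(2,1)]] by (simp only: not_le)

lemma decidable_in_eq:
  assumes "computable_in X f" "computable_in X g"
  shows "decidable_in X (\<lambda>x. f x = g x)"
  using decidable_in_conj[OF decidable_in_le[OF assms] decidable_in_le[OF assms(2,1)]]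
  by (simp only: order_eq_iff[symmetric])

lemma decidable_in_iff:
  assumes "decidable_in X P" "decidable_in X Q"
  shows "decidable_in X (\<lambda>x. P x \<longleftrightarrow> Q x)"
  using decidable_in_eq[OF assms[unfolded decidable_in_def]] by (simp add: of_bool_eq_iff)

lemma computable_in_if:
  assumes "decidable_in X P" "computable_in X f" "computable_in X g"
  shows "computable_in X (\<lambda>x. if P x then f x else g x)"
proof -
  have "computable_in X (\<lambda>x. of_bool (P x) * f x + of_bool (\<not> P x) * g x)"
    by (intro computable_in_mult computable_in_add assms assms(1)[unfolded decidable_in_def]
        decidable_in_not[OF assms(1), unfolded decidable_in_def])
  moreover have "(\<lambda>x. of_bool (P x) * f x + of_bool (\<not> P x) * g x) =
      (\<lambda>x. if P x then f x else g x)"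
    by auto
  ultimately show ?thesis by simp
qed

lemma computable_in_card:
  assumes "computable_in X g" "decidable_in X (\<lambda>z. P (pfst z) (psnd z))"
  shows "computable_in X (\<lambda>x. card {n. n < g x \<and> P x n})"
proof -
  have "computable_in X (\<lambda>x. \<Sum>n<g x. of_bool (P x n))"
    by (intro computable_in_sum assms assms(2)[unfolded decidable_in_def])
  moreover have "(\<Sum>n<b. of_bool (P x n)) = card {n. n < b \<and> P x n}" for x b
    by (simp add: lessThan_def Collect_conj_eq Int_commute)
  ultimately show ?thesis by simp
qed

lemma decidable_in_bex:
  assumes "computable_in X g" "decidable_in X (\<lambda>z. P (pfst z) (psnd z))"
  shows "decidable_in X (\<lambda>x. \<exists>n<g x. P x n)"
proof -
  have "decidable_in X (\<lambda>x. 0 < card {n. n < g x \<and> P x n})"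
    by (intro decidable_in_less computable_in_const computable_in_card assms)
  moreover have "0 < card {n. n < b \<and> P x n} \<longleftrightarrow> (\<exists>n<b. P x n)" for x b
    by (auto simp: card_gt_0_iff)
  ultimately show ?thesis by simp
qed

lemma computable_in_Least:
  assumes ex: "\<And>x. \<exists>n. P x n" and P: "decidable_in X (\<lambda>z. P (pfst z) (psnd z))"
  shows "computable_in X (\<lambda>x. LEAST n. P x n)"
proof -
  \<comment> \<open>\<open>MuP\<close> looks for a zero, so the program tests the negation of
    \<open>P\<close>; \<open>ex\<close> makes the search halt on every input.\<close>
  obtain p where p: "\<And>z. eval X p z (of_bool (\<not> P (pfst z) (psnd z)))"
    using decidable_in_not[OF P] unfolding decidable_in_def computable_in_def by blast
  have "eval X (MuP p) x (LEAST n. P x n)" for x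
  proof (rule eval.Mu)
    show "eval X p (prod_encode (x, LEAST n. P x n)) 0"
      using p[of "prod_encode (x, LEAST n. P x n)"] LeastI_ex[OF ex[of x]] by simp
  next
    fix m assume "m < (LEAST n. P x n)"
    then show "\<exists>k. eval X p (prod_encode (x, m)) (Suc k)"
      using p[of "prod_encode (x, m)"] not_less_Least by fastforce
  qed
  then show ?thesis unfolding computable_in_def by blast
qed

lemma computable_in_div:
  assumes "computable_in X f" "0 < c"
  shows "computable_in X (\<lambda>x. f x div c)"
proof -
  have "(LEAST q. a < c * Suc q) = a div c" for a :: nat
  proof (rule Least_equality)
    show "a < c * Suc (a div c)" using dividend_less_times_div[OF \<open>0 < c\<close>, of a] by simp
    show "a div c \<le> y" if "a < c * Suc y" for y
      using that \<open>0 < c\<close> by (metis less_Suc_eq_le less_mult_imp_div_less mult.commute)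
  qed
  moreover have "\<exists>q. f x < c * Suc q" for x
    using dividend_less_times_div[OF \<open>0 < c\<close>, of "f x"] by (metis mult_Suc_right)
  then have "computable_in X (\<lambda>x. LEAST q. f x < c * Suc q)"
    by (intro computable_in_Least decidable_in_less computable_in_comp[OF assms(1)]
        computable_in_mult computable_basic_intros)
  ultimately show ?thesis by simp
qed

lemma computable_in_mod:
  assumes "computable_in X f" "0 < c"
  shows "computable_in X (\<lambda>x. f x mod c)"
proof -
  have "computable_in X (\<lambda>x. f x - c * (f x div c))"
    by (intro computable_in_diff computable_in_mult computable_in_const computable_in_div assms)
  then show ?thesis by (simp add: minus_mult_div_eq_mod)
qed

lemmas computable_intros = computable_in_const computable_in_id computable_in_Suc
  computable_in_pfst computable_in_psnd computable_in_prod_encode computable_in_add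
  computable_in_mult computable_in_diff computable_in_div computable_in_mod computable_in_if
  computable_in_card computable_in_sum decidable_in_const decidable_in_not decidable_in_conj
  decidable_in_disj decidable_in_imp decidable_in_iff decidable_in_le decidable_in_less
  decidable_in_eq decidable_in_bex

section \<open>The jump decides one more quantifier\<close>

definition phi_halts :: "nat set \<Rightarrow> nat \<Rightarrow> nat \<Rightarrow> bool" where
  "phi_halts X e x \<longleftrightarrow> (\<exists>y. eval X (inv index e) x y)"

text \<open>The value 0 on divergence makes \<open>phi X e\<close> a total function for every index,
  and one that \<open>jump X\<close> can compute.\<close>

definition phi :: "nat set \<Rightarrow> nat \<Rightarrow> nat \<Rightarrow> nat" where
  "phi X e x = (if phi_halts X e x then THE y. eval X (inv index e) x y else 0)"

lemma inv_index [simp]: "inv index (index p) = p"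
  using inj_index by simp

lemma index_inv [simp]: "index (inv index e) = e"
  using surj_index by (simp add: surj_f_inv_f)

lemma phi_eqI: "eval X (inv index e) x y \<Longrightarrow> phi X e x = y"
  unfolding phi_def phi_halts_def by (metis eval_deterministic the_equality)

lemma phi_eval: "phi_halts X e x \<Longrightarrow> eval X (inv index e) x (phi X e x)"
  using phi_eqI unfolding phi_halts_def by blast

lemma computable_in_phi: "(\<And>x. phi_halts X e x) \<Longrightarrow> computable_in X (phi X e)"
  unfolding computable_in_def using phi_eval by blast

lemma computable_in_phiE:
  assumes "computable_in X f"
  obtains e where "phi X e = f" "\<And>x. phi_halts X e x"
proof -
  obtain p where "\<And>x. eval X p x (f x)" using assms unfolding computable_in_def by blast
  then have "eval X (inv index (index p)) x (f x)" for x by simp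
  then show ?thesis
    using that[of "index p"] phi_eqI unfolding phi_halts_def by blast
qed

text \<open>The recursion follows \<open>const_prog\<close>: 6 is the tag of \<open>CompP\<close>
  and 1 the index of \<open>SuccP\<close>. It lets an oracle machine compute which halting question
  to ask.\<close>

definition const_index :: "nat \<Rightarrow> nat" where
  "const_index n = rec_nat 0 (\<lambda>_ r. 6 + 4 * prod_encode (1, r)) n"

lemma index_const_prog: "index (const_prog n) = const_index n"
  by (induction n) (auto simp: const_index_def)

lemma computable_in_const_index: "computable_in X f \<Longrightarrow> computable_in X (\<lambda>x. const_index (f x))"
  unfolding const_index_def by (intro computable_intros computable_in_rec_nat)

lemma decidable_in_oracle: "computable_in X f \<Longrightarrow> decidable_in X (\<lambda>x. f x \<in> X)"
proof -
  assume "computable_in X f"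
  moreover have "char_fun X = (\<lambda>x. of_bool (x \<in> X))" unfolding char_fun_def by auto
  ultimately show ?thesis
    using computable_in_comp[OF computable_in_oracle, of X f] unfolding decidable_in_def by simp
qed

text \<open>A program that ignores its input halts on its own index iff it halts anywhere.\<close>

lemma phi_halts_iff_jump:
  "phi_halts X e x \<longleftrightarrow> 6 + 4 * prod_encode (e, const_index x) \<in> jump X"
proof -
  let ?q = "CompP (inv index e) (const_prog x)"
  have i: "index ?q = 6 + 4 * prod_encode (e, const_index x)"
    by (simp add: index_const_prog)
  have "(\<exists>y. eval X ?q z y) \<longleftrightarrow> phi_halts X e x" for z
    unfolding phi_halts_def
  proof
    assume "\<exists>y. eval X ?q z y"
    then show "\<exists>y. eval X (inv index e) x y"
      by (auto elim!: eval_CompE dest!: eval_deterministic[OF eval_const_prog])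
  next
    assume "\<exists>y. eval X (inv index e) x y"
    then show "\<exists>y. eval X ?q z y" using eval.Comp[OF eval_const_prog] by blast
  qed
  moreover have "index ?q \<in> jump X \<longleftrightarrow> (\<exists>y. eval X ?q (index ?q) y)"
    unfolding jump_def mem_Collect_eq by (metis inv_index)
  ultimately have "phi_halts X e x \<longleftrightarrow> index ?q \<in> jump X" by blast
  then show ?thesis unfolding i .
qed

lemma decidable_in_phi_halts:
  "computable_in (jump X) f \<Longrightarrow> computable_in (jump X) g \<Longrightarrow>
    decidable_in (jump X) (\<lambda>x. phi_halts X (f x) (g x))"
  unfolding phi_halts_iff_jump
  by (intro decidable_in_oracle computable_intros computable_in_const_index)

text \<open>A witness exists iff the unbounded search for it halts, and the jump decides
  halting.\<close>

lemma decidable_in_jump_ex: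
  assumes P: "decidable_in X (\<lambda>z. P (pfst z) (psnd z))"
  shows "decidable_in (jump X) (\<lambda>x. \<exists>n. P x n)"
proof -
  obtain p where p: "\<And>z. eval X p z (of_bool (\<not> P (pfst z) (psnd z)))"
    using decidable_in_not[OF P] unfolding decidable_in_def computable_in_def by blast
  have p': "eval X p (prod_encode (x, n)) y \<longleftrightarrow> y = of_bool (\<not> P x n)" for x n y
    using p[of "prod_encode (x, n)"] eval_deterministic by fastforce
  have "(\<exists>n. P x n) \<longleftrightarrow> phi_halts X (index (MuP p)) x" for x
  proof
    assume "\<exists>n. P x n"
    then have "P x (LEAST n. P x n)" by (rule LeastI_ex)
    then have "eval X (MuP p) x (LEAST n. P x n)"
      by (intro eval.Mu) (auto simp: p' dest: not_less_Least)
    then show "phi_halts X (index (MuP p)) x" unfolding phi_halts_def inv_index by blast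
  next
    assume "phi_halts X (index (MuP p)) x"
    then show "\<exists>n. P x n"
      unfolding phi_halts_def inv_index by (auto elim!: eval_MuE simp: p' split: if_splits)
  qed
  then show ?thesis by (simp only: decidable_in_phi_halts computable_in_const computable_in_id)
qed

section \<open>Transitivity of relative computability\<close>

fun oracle_subst :: "prog \<Rightarrow> prog \<Rightarrow> prog" where
  "oracle_subst r OracleP = r"
| "oracle_subst r (PairP p q) = PairP (oracle_subst r p) (oracle_subst r q)"
| "oracle_subst r (CompP p q) = CompP (oracle_subst r p) (oracle_subst r q)"
| "oracle_subst r (PrecP p q) = PrecP (oracle_subst r p) (oracle_subst r q)"
| "oracle_subst r (MuP p) = MuP (oracle_subst r p)"
| "oracle_subst r p = p"

text \<open>Every oracle call to \<open>X\<close> is replaced by the program \<open>r\<close>, which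
  computes the answer from \<open>Y\<close>.\<close>

lemma eval_oracle_subst:
  assumes r: "\<And>x. eval Y r x (char_fun X x)"
  shows "eval X p x y \<Longrightarrow> eval Y (oracle_subst r p) x y"
proof (induction rule: eval.induct)
  case (Oracle x)
  then show ?case using r[of x] by (simp add: char_fun_def)
next
  case (Mu p x n)
  then show ?case by (auto intro!: eval.Mu)
next
  case (Prec_Suc p q a n r y)
  then show ?case using eval.Prec_Suc by simp
qed (simp_all add: eval.Zero eval.Succ eval.Fst eval.Snd eval.Pair eval.Comp eval.Prec_0)

lemma computable_in_turing_le: "X \<le>\<^sub>T Y \<Longrightarrow> computable_in X f \<Longrightarrow> computable_in Y f"
  unfolding turing_le_def computable_in_def using eval_oracle_subst by blast

lemma turing_le_jump: "X \<le>\<^sub>T jump X"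
proof -
  have "decidable_in (jump X) (\<lambda>x. \<exists>n::nat. x \<in> X)"
    by (intro decidable_in_jump_ex decidable_in_oracle computable_intros)
  moreover have "char_fun X = (\<lambda>x. of_bool (x \<in> X))" unfolding char_fun_def by auto
  ultimately show ?thesis unfolding turing_le_def decidable_in_def by simp
qed

lemma computable_in_jump: "computable_in X f \<Longrightarrow> computable_in (jump X) f"
  using computable_in_turing_le turing_le_jump by blast

lemma decidable_in_jump: "decidable_in X P \<Longrightarrow> decidable_in (jump X) P"
  unfolding decidable_in_def by (rule computable_in_jump)

lemma decidable_in_jump_all:
  assumes "decidable_in X (\<lambda>z. P (pfst z) (psnd z))"
  shows "decidable_in (jump X) (\<lambda>x. \<forall>n. P x n)"
  using decidable_in_not[OF decidable_in_jump_ex[OF decidable_in_not[OF assms]]] by simp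

text \<open>Two like quantifiers contract to one over coded pairs, so a block of them costs a single
  jump.\<close>

lemma decidable_in_jump_all2:
  assumes "decidable_in X (\<lambda>z. P (pfst z) (pfst (psnd z)) (psnd (psnd z)))"
  shows "decidable_in (jump X) (\<lambda>x. \<forall>m n. P x m n)"
proof -
  have "decidable_in (jump X) (\<lambda>x. \<forall>z. P x (pfst z) (psnd z))"
    by (intro decidable_in_jump_all assms)
  moreover have "(\<forall>z. P x (pfst z) (psnd z)) \<longleftrightarrow> (\<forall>m n. P x m n)" for x
    by (metis fst_conv snd_conv prod_encode_inverse)
  ultimately show ?thesis by simp
qed

text \<open>The graph of \<open>phi X\<close> reduces to halting: from \<open>e\<close>,
  \<open>x\<close>, \<open>y\<close> one builds a program that halts iff \<open>e\<close> on
  \<open>x\<close> outputs \<open>y\<close>. The jump then searches for the right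
  \<open>y\<close>.\<close>

lemma computable_in_jump_phi:
  assumes "computable_in (jump X) f" "computable_in (jump X) g"
  shows "computable_in (jump X) (\<lambda>x. phi X (f x) (g x))"
proof -
  have "decidable_in X (\<lambda>z. pfst z \<noteq> psnd z)" by (intro computable_intros)
  then obtain E where E: "\<And>z. eval X E z (of_bool (pfst z \<noteq> psnd z))"
    unfolding decidable_in_def computable_in_def by blast
  \<comment> \<open>The test inside \<open>T\<close> ignores the search variable, so the search
    succeeds at 0 when the two components agree and runs forever otherwise.\<close>
  define T where "T = MuP (CompP E FstP)"
  have E': "eval X (CompP E FstP) (prod_encode (z, n)) y \<longleftrightarrow> y = of_bool (pfst z \<noteq> psnd z)"
    for z n y
  proof -
    have "eval X (CompP E FstP) (prod_encode (z, n)) (of_bool (pfst z \<noteq> psnd z))"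
      using eval.Comp[OF eval.Fst E, of "prod_encode (z, n)"] by simp
    then show ?thesis using eval_deterministic by blast
  qed
  have T: "(\<exists>y. eval X T z y) \<longleftrightarrow> pfst z = psnd z" for z
  proof
    show "\<exists>y. eval X T z y \<Longrightarrow> pfst z = psnd z"
      unfolding T_def by (auto elim!: eval_MuE simp: E' split: if_splits)
    assume "pfst z = psnd z"
    then have "eval X T z 0" unfolding T_def by (intro eval.Mu) (auto simp: E')
    then show "\<exists>y. eval X T z y" by blast
  qed
  \<comment> \<open>The index of "compute the pair of the output of \<open>e\<close> on
    \<open>x\<close> and of \<open>y\<close>, then run \<open>T\<close>"; 5 and 6 are the tags of
    \<open>PairP\<close> and \<open>CompP\<close>.\<close>
  define G where "G e x y = 6 + 4 * prod_encode (index T,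
      5 + 4 * prod_encode (6 + 4 * prod_encode (e, const_index x), const_index y))" for e x y
  have graph: "phi_halts X (G e x y) 0 \<longleftrightarrow> phi_halts X e x \<and> phi X e x = y" for e x y
  proof -
    let ?q = "CompP T (PairP (CompP (inv index e) (const_prog x)) (const_prog y))"
    have "G e x y = index ?q" by (simp add: G_def index_const_prog)
    then have "phi_halts X (G e x y) 0 \<longleftrightarrow> (\<exists>u. eval X ?q 0 u)"
      unfolding phi_halts_def by (simp only: inv_index)
    also have "\<dots> \<longleftrightarrow> (\<exists>z. eval X (PairP (CompP (inv index e) (const_prog x)) (const_prog y)) 0 z
        \<and> pfst z = psnd z)"
      unfolding T[symmetric] by (auto elim!: eval_CompE[of X T] intro: eval.Comp)
    also have "\<dots> \<longleftrightarrow> eval X (inv index e) x y"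
    proof
      assume "\<exists>z. eval X (PairP (CompP (inv index e) (const_prog x)) (const_prog y)) 0 z
        \<and> pfst z = psnd z"
      then show "eval X (inv index e) x y"
        by (auto elim!: eval_PairE eval_CompE
            dest!: eval_deterministic[OF eval_const_prog])
    next
      assume "eval X (inv index e) x y"
      then have "eval X (PairP (CompP (inv index e) (const_prog x)) (const_prog y)) 0
          (prod_encode (y, y))"
        by (intro eval.Pair eval.Comp[OF eval_const_prog] eval_const_prog)
      then show "\<exists>z. eval X (PairP (CompP (inv index e) (const_prog x)) (const_prog y)) 0 z
        \<and> pfst z = psnd z"
        by fastforce
    qed
    also have "\<dots> \<longleftrightarrow> phi_halts X e x \<and> phi X e x = y"
      using phi_eqI phi_eval phi_halts_def by blast
    finally show ?thesis .
  qed
  \<comment> \<open>The first disjunct makes the search total and yields the default 0 on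
    divergence.\<close>
  have "phi X e x = (LEAST y. \<not> phi_halts X e x \<or> phi_halts X (G e x y) 0)" for e x
    unfolding graph by (rule sym, rule Least_equality) (auto simp: phi_def)
  moreover have "computable_in (jump X)
      (\<lambda>z. LEAST y. \<not> phi_halts X (f z) (g z) \<or> phi_halts X (G (f z) (g z) y) 0)"
  proof (rule computable_in_Least)
    show "\<exists>y. \<not> phi_halts X (f z) (g z) \<or> phi_halts X (G (f z) (g z) y) 0" for z
      unfolding graph by blast
    show "decidable_in (jump X) (\<lambda>z. \<not> phi_halts X (f (pfst z)) (g (pfst z)) \<or>
        phi_halts X (G (f (pfst z)) (g (pfst z)) (psnd z)) 0)"
      unfolding G_def
      by (intro computable_intros decidable_in_phi_halts computable_in_const_index
          computable_in_comp[OF assms(1)] computable_in_comp[OF assms(2)])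
  qed
  ultimately show ?thesis by simp
qed

section \<open>Extending a condition\<close>

text \<open>\<open>b\<close> is evidence for \<open>n\<close>. Searching for a pair whose first
  component exceeds the last one chosen lists infinitely many of the \<open>n\<close> with evidence
  in increasing order.\<close>

lemma computable_selection:
  assumes P: "decidable_in X (\<lambda>z. P (pfst z) (psnd z))"
    and ex: "\<And>m. \<exists>n>m. \<exists>b. P n b"
  obtains s where "computable_in X s" "strict_mono s" "\<And>n. M < s n" "\<And>n. \<exists>b. P (s n) b"
proof -
  define nx where "nx m = pfst (LEAST z. m < pfst z \<and> P (pfst z) (psnd z))" for m
  have ex': "\<exists>z. m < pfst z \<and> P (pfst z) (psnd z)" for m
    using ex[of m] by (metis fst_conv snd_conv prod_encode_inverse)
  have nx: "m < nx m \<and> (\<exists>b. P (nx m) b)" for m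
    using LeastI_ex[OF ex'[of m]] unfolding nx_def by blast
  have comp_nx: "computable_in X nx"
    unfolding nx_def
    by (intro computable_intros computable_in_Least ex' decidable_in_comp2[OF P])
  define s where "s n = rec_nat (nx M) (\<lambda>_. nx) n" for n
  have "computable_in X s"
    unfolding s_def
    by (intro computable_in_rec_nat computable_intros computable_in_comp[OF comp_nx])
  moreover have mono: "strict_mono s"
    unfolding strict_mono_Suc_iff s_def using nx by simp
  moreover have "M < s n" for n
    using nx[of M] strict_mono_less_eq[OF mono, of 0 n] by (simp add: s_def)
  moreover have "\<exists>b. P (s n) b" for n
    by (cases n) (use nx in \<open>auto simp: s_def\<close>)
  ultimately show ?thesis using that by blast
qed

text \<open>If \<open>f\<close> changes some colour, deciding at most two classes creates a
  disagreement between \<open>A'\<close> at a point and at its image. \<open>M\<close> bounds the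
  colours that must become decided to preserve it.\<close>

lemma decide_against_reduction:
  assumes \<gamma>: "computable_in {} \<gamma>" and A: "decidable_in {} A"
  shows "\<exists>A' M. decidable_in {} A' \<and> (\<forall>x. \<gamma> x = 0 \<longrightarrow> (A' x \<longleftrightarrow> A x)) \<and>
    (\<forall>x y. \<gamma> x = \<gamma> y \<and> \<gamma> x \<noteq> 0 \<longrightarrow> (A' x \<longleftrightarrow> A' y)) \<and>
    ((\<exists>x. \<gamma> x \<le> M \<and> \<gamma> (f x) \<le> M \<and> (A' x \<longleftrightarrow> \<not> A' (f x))) \<or> (\<forall>x. \<gamma> (f x) = \<gamma> x))"
proof (cases "\<forall>x. \<gamma> (f x) = \<gamma> x")
  case True
  have "decidable_in {} (\<lambda>x. A x \<and> \<gamma> x = 0)" by (intro computable_intros A \<gamma>)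
  with True show ?thesis by (intro exI[of _ "\<lambda>x. A x \<and> \<gamma> x = 0"]) auto
next
  case False
  then obtain x where x: "\<gamma> (f x) \<noteq> \<gamma> x" by blast
  \<comment> \<open>The two colours differ, so one of them is nonzero: \<open>z\<close> is a point
    of such a colour and \<open>q\<close> is the other point.\<close>
  then obtain z q where zq: "z = x \<and> q = f x \<or> z = f x \<and> q = x" "\<gamma> z \<noteq> 0" "\<gamma> q \<noteq> \<gamma> z"
    by (metis (full_types) neq0_conv)
  \<comment> \<open>The class of \<open>z\<close> is decided opposite to \<open>q\<close>. If
    \<open>q\<close> is itself undecided, its class is excluded and that of \<open>z\<close>
    included.\<close>
  define b where "b \<longleftrightarrow> \<not> (\<gamma> q = 0 \<and> A q)"
  define A' where "A' y \<longleftrightarrow> (A y \<and> \<gamma> y = 0) \<or> (\<gamma> y = \<gamma> z \<and> b)" for y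
  have "decidable_in {} A'"
    unfolding A'_def by (intro computable_intros A \<gamma>)
  moreover have "A' z \<longleftrightarrow> \<not> A' q" using zq by (auto simp: A'_def b_def)
  then have "\<exists>x. \<gamma> x \<le> max (\<gamma> z) (\<gamma> q) \<and> \<gamma> (f x) \<le> max (\<gamma> z) (\<gamma> q) \<and> (A' x \<longleftrightarrow> \<not> A' (f x))"
    using zq(1) by (intro exI[of _ x]) auto
  ultimately show ?thesis
    using zq(2) by (intro exI[of _ A'] exI[of _ "max (\<gamma> z) (\<gamma> q)"]) (auto simp: A'_def)
qed

lemma card_preimage_class_le:
  fixes f \<gamma> :: "nat \<Rightarrow> nat"
  assumes "finite {x. \<gamma> x = c}" "card {x. \<gamma> x = c} \<le> L"
    and "\<And>y. card {x. x < b \<and> f x = y} \<le> k"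
  shows "card {x. x < b \<and> \<gamma> (f x) = c} \<le> L * k"
proof -
  have "card {x. x < b \<and> \<gamma> (f x) = c} \<le> card (\<Union>y\<in>{x. \<gamma> x = c}. {x. x < b \<and> f x = y})"
    by (intro card_mono) (auto intro: assms(1))
  also have "\<dots> \<le> (\<Sum>y\<in>{x. \<gamma> x = c}. card {x. x < b \<and> f x = y})"
    by (rule card_UN_le[OF assms(1)])
  also have "\<dots> \<le> card {x. \<gamma> x = c} * k"
    using sum_bounded_above[of "{x. \<gamma> x = c}" "\<lambda>y. card {x. x < b \<and> f x = y}" k] assms(3)
    by simp
  also have "\<dots> \<le> L * k" using assms(2) by simp
  finally show ?thesis .
qed

lemma card_bounded_mono:
  "b \<le> b' \<Longrightarrow> card {x::nat. x < b \<and> P x} \<le> card {x. x < b' \<and> P x}"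
  by (intro card_mono) auto

text \<open>The value \<open>v\<close> is the largest number of preimages attained by infinitely many classes.\<close>

lemma homogenize_preimage_count:
  assumes \<gamma>: "computable_in {} \<gamma>" and f: "computable_in {} f"
    and L: "\<And>i. finite {x. \<gamma> x = Suc i}" "\<And>i. card {x. \<gamma> x = Suc i} \<le> L"
  shows "\<exists>s v q. computable_in {} s \<and> strict_mono s \<and> (\<forall>n. M < s n) \<and> computable_in {} q \<and>
    ((\<forall>y b. card {x. x < b \<and> f x = y} \<le> k) \<longrightarrow>
      (\<forall>i b. q i \<le> b \<longrightarrow> card {x. x < b \<and> \<gamma> (f x) = Suc (s i)} = v))"
proof (cases "\<forall>y b. card {x. x < b \<and> f x = y} \<le> k")
  \<comment> \<open>The statement about the counts is then vacuous, and any tail beyond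
    \<open>M\<close> will do.\<close>
  case False
  have "computable_in {} (\<lambda>n. n + Suc M)" by (intro computable_intros)
  moreover have "strict_mono (\<lambda>n. n + Suc M)" by (simp add: strict_mono_def)
  ultimately show ?thesis
    using False computable_in_id[of "{}"] by (intro exI[of _ "\<lambda>n. n + Suc M"]) auto
next
  case True
  define c where "c i b = card {x. x < b \<and> \<gamma> (f x) = Suc i}" for i b
  have c_mono: "c i b \<le> c i b'" if "b \<le> b'" for i b b'
    unfolding c_def using that by (rule card_bounded_mono)
  have c_le: "c i b \<le> L * k" for i b
    unfolding c_def using L True by (intro card_preimage_class_le) auto
  have c_comp: "computable_in {} (\<lambda>z. c (pfst z) (psnd z))"
    unfolding c_def by (intro computable_intros computable_in_comp[OF \<gamma>] computable_in_comp[OF f])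
  define I where "I v \<longleftrightarrow> (\<forall>m. \<exists>n>m. \<exists>b. v \<le> c n b)" for v
  have "I 0" by (auto simp: I_def)
  moreover have "v \<le> L * k" if "I v" for v
    using that c_le unfolding I_def by (meson le_trans)
  ultimately obtain v where v: "I v" "\<And>v'. I v' \<Longrightarrow> v' \<le> v"
    using GreatestI_nat[of I 0 "L * k"] Greatest_le_nat[of I _ "L * k"] by blast
  then have "\<not> I (Suc v)" by fastforce
  \<comment> \<open>Only finitely many classes ever reach \<open>Suc v\<close> preimages, so beyond
    \<open>N\<close> the counts stay at most \<open>v\<close>.\<close>
  then obtain N where N: "\<And>n b. N < n \<Longrightarrow> c n b \<le> v"
    unfolding I_def by (metis not_less_eq_eq)
  obtain s where s: "computable_in {} s" "strict_mono s" "\<And>n. max M N < s n"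
    "\<And>n. \<exists>b. v \<le> c (s n) b"
  proof (rule computable_selection[of "{}" "\<lambda>n b. v \<le> c n b" "max M N"])
    show "decidable_in {} (\<lambda>z. v \<le> c (pfst z) (psnd z))"
      by (intro computable_intros c_comp)
    show "\<exists>n>m. \<exists>b. v \<le> c n b" for m using v(1) unfolding I_def by blast
  qed blast
  \<comment> \<open>A modulus for the count: once \<open>v\<close> preimages have appeared below
    \<open>q n\<close>, the count can neither fall, being monotone, nor rise above
    \<open>v\<close>.\<close>
  define q where "q n = (LEAST b. v \<le> c (s n) b)" for n
  have "computable_in {} q"
    unfolding q_def
    by (intro computable_in_Least s(4) computable_intros computable_in_comp2[OF c_comp]
        computable_in_comp[OF s(1)])
  moreover have "c (s i) b = v" if "q i \<le> b" for i b
  proof (rule antisym)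
    show "c (s i) b \<le> v" using N s(3)[of i] by simp
    have "v \<le> c (s i) (q i)" unfolding q_def by (rule LeastI_ex[OF s(4)])
    then show "v \<le> c (s i) b" using c_mono[OF that] by (rule order.trans)
  qed
  ultimately show ?thesis
    using s by (intro exI[of _ s] exI[of _ v] exI[of _ q]) (auto simp: c_def)
qed

text \<open>
  A condition is a pair of a colouring \<open>\<beta>\<close> and a predicate \<open>A\<close>. The points of colour \<open>0\<close> are the
  decided ones, and \<open>A\<close> tells which of them belong to the set under construction; each other
  colour class is to be included or excluded as a whole. The numbers \<open>v\<close>, \<open>q\<close> and \<open>w\<close>
  are Skolem witnesses that keep the extension relation simple enough for the oracle.
\<close>

definition extends ::
  "nat \<Rightarrow> (nat \<Rightarrow> nat) \<Rightarrow> (nat \<Rightarrow> bool) \<Rightarrow> (nat \<Rightarrow> nat) \<Rightarrow> (nat \<Rightarrow> bool) \<Rightarrow> (nat \<Rightarrow> nat) \<Rightarrow> bool" where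
  "extends t \<beta> A \<beta>' A' w \<longleftrightarrow>
    (\<forall>i. pfst (w i) \<noteq> psnd (w i)) \<and>
    (\<forall>i x. \<beta>' x = Suc i \<longleftrightarrow> \<beta> x = Suc (pfst (w i)) \<or> \<beta> x = Suc (psnd (w i))) \<and>
    (\<forall>x. \<beta> x = 0 \<longrightarrow> (A' x \<longleftrightarrow> A x)) \<and>
    (\<forall>x y. \<beta> x = \<beta> y \<and> \<beta> x \<noteq> 0 \<longrightarrow> (A' x \<longleftrightarrow> A' y)) \<and>
    \<beta>' t = 0"

text \<open>The modulus \<open>q\<close> replaces the claim that each class has exactly
  \<open>v\<close> preimages. That claim would put an existential quantifier after the one over
  \<open>i\<close>, whereas here one block of universal quantifiers suffices.\<close>

definition forces :: "(nat \<Rightarrow> nat) \<Rightarrow> nat \<Rightarrow> (nat \<Rightarrow> nat) \<Rightarrow> (nat \<Rightarrow> bool) \<Rightarrow> nat \<Rightarrow> (nat \<Rightarrow> nat) \<Rightarrow> bool" where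
  "forces f k \<beta>' A' v q \<longleftrightarrow>
    ((\<exists>x. \<beta>' x = 0 \<and> \<beta>' (f x) = 0 \<and> (A' x \<longleftrightarrow> \<not> A' (f x))) \<or> (\<forall>x. \<beta>' (f x) = \<beta>' x)) \<and>
    ((\<forall>y b. card {x. x < b \<and> f x = y} \<le> k) \<longrightarrow>
      (\<forall>i b. q i \<le> b \<longrightarrow> card {x. x < b \<and> \<beta>' (f x) = Suc i} = v))"

text \<open>Three operations in turn: merge classes in pairs, decide against \<open>f\<close> as a
  reduction, and thin out to classes with a constant number of preimages. The discarded classes
  receive colour 0 and are decided by \<open>A'\<close>.\<close>

lemma extension_exists:
  assumes \<beta>: "computable_in {} \<beta>" and A: "decidable_in {} A" and f: "computable_in {} f"
    and L: "\<And>i. finite {x. \<beta> x = Suc i}" "\<And>i. card {x. \<beta> x = Suc i} \<le> L"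
  shows "\<exists>\<beta>' A' v q w. computable_in {} \<beta>' \<and> decidable_in {} A' \<and> computable_in {} q \<and>
    computable_in {} w \<and> extends t \<beta> A \<beta>' A' w \<and> forces f k \<beta>' A' v q"
proof -
  \<comment> \<open>This merges the colours \<open>2 * i + 1\<close> and \<open>2 * i + 2\<close>
    into \<open>i + 1\<close> and keeps 0.\<close>
  define \<gamma> where "\<gamma> x = Suc (\<beta> x) div 2" for x
  have \<gamma>: "computable_in {} \<gamma>" unfolding \<gamma>_def by (intro computable_intros \<beta>) simp
  have \<gamma>_Suc: "\<gamma> x = Suc i \<longleftrightarrow> \<beta> x = Suc (2 * i) \<or> \<beta> x = Suc (Suc (2 * i))" for x i
    unfolding \<gamma>_def by presburger
  have \<gamma>_0: "\<gamma> x = 0 \<longleftrightarrow> \<beta> x = 0" for x unfolding \<gamma>_def by presburger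
  have split: "{x. \<gamma> x = Suc i} = {x. \<beta> x = Suc (2 * i)} \<union> {x. \<beta> x = Suc (Suc (2 * i))}" for i
    unfolding \<gamma>_Suc by blast
  have fin: "finite {x. \<gamma> x = Suc i}" for i unfolding split using L(1) by blast
  have card: "card {x. \<gamma> x = Suc i} \<le> 2 * L" for i
    unfolding split
    using card_Un_le[of "{x. \<beta> x = Suc (2 * i)}" "{x. \<beta> x = Suc (Suc (2 * i))}"]
      L(2)[of "2 * i"] L(2)[of "Suc (2 * i)"] by linarith
  obtain A' M where A': "decidable_in {} A'"
    and A'_0: "\<And>x. \<gamma> x = 0 \<Longrightarrow> A' x \<longleftrightarrow> A x"
    and A'_eq: "\<And>x y. \<gamma> x = \<gamma> y \<Longrightarrow> \<gamma> x \<noteq> 0 \<Longrightarrow> A' x \<longleftrightarrow> A' y"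
    and rigid: "(\<exists>x. \<gamma> x \<le> M \<and> \<gamma> (f x) \<le> M \<and> (A' x \<longleftrightarrow> \<not> A' (f x))) \<or> (\<forall>x. \<gamma> (f x) = \<gamma> x)"
    using decide_against_reduction[OF \<gamma> A, of f] by blast
  \<comment> \<open>Only classes beyond \<open>M\<close> and beyond the colour of \<open>t\<close>
    are kept, so that both the disagreement and the number \<open>t\<close> become decided.\<close>
  obtain s v q where s: "computable_in {} s" "strict_mono s" "\<And>n. max M (\<gamma> t) < s n"
    and q: "computable_in {} q"
    and count: "(\<forall>y b. card {x. x < b \<and> f x = y} \<le> k) \<longrightarrow>
      (\<forall>i b. q i \<le> b \<longrightarrow> card {x. x < b \<and> \<gamma> (f x) = Suc (s i)} = v)"
    using homogenize_preimage_count[OF \<gamma> f fin card, of "max M (\<gamma> t)" k] by blast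
  \<comment> \<open>The inverse of \<open>s\<close>, as a bounded sum: at most one summand is
    nonzero because \<open>s\<close> is injective, and the bound suffices because
    \<open>n \<le> s n\<close>. Classes that \<open>s\<close> misses get colour 0.\<close>
  define \<beta>' where "\<beta>' x = (\<Sum>n<\<gamma> x. if Suc (s n) = \<gamma> x then Suc n else 0)" for x
  have \<beta>': "computable_in {} \<beta>'"
    unfolding \<beta>'_def by (intro computable_intros computable_in_comp[OF \<gamma>] computable_in_comp[OF s(1)])
  have \<beta>'_Suc': "\<beta>' x = Suc n" if "\<gamma> x = Suc (s n)" for x n
  proof -
    have "Suc (s m) = \<gamma> x \<longleftrightarrow> m = n" for m
      using that strict_mono_eq[OF s(2), of m n] by simp
    then have "\<beta>' x = (\<Sum>m<\<gamma> x. if m = n then Suc m else 0)" unfolding \<beta>'_def by simp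
    also have "n < \<gamma> x" using that strict_mono_imp_increasing[OF s(2), of n] by simp
    then have "(\<Sum>m<\<gamma> x. if m = n then Suc m else 0) = Suc n" by simp
    finally show ?thesis .
  qed
  have \<beta>'_Suc: "\<beta>' x = Suc i \<longleftrightarrow> \<gamma> x = Suc (s i)" for x i
  proof
    assume i: "\<beta>' x = Suc i"
    then have "(\<Sum>n<\<gamma> x. if Suc (s n) = \<gamma> x then Suc n else 0) \<noteq> 0"
      unfolding \<beta>'_def by simp
    then obtain n where "Suc (s n) = \<gamma> x"
      by (auto elim!: sum.not_neutral_contains_not_neutral split: if_splits)
    then have "\<gamma> x = Suc (s n)" by (rule sym)
    from this \<beta>'_Suc'[OF this] show "\<gamma> x = Suc (s i)" using i by simp
  qed (rule \<beta>'_Suc')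
  have \<beta>'_0: "\<beta>' x = 0" if "\<gamma> x \<le> max M (\<gamma> t)" for x
  proof (rule ccontr)
    assume "\<beta>' x \<noteq> 0"
    then obtain i where "\<beta>' x = Suc i" by (cases "\<beta>' x") auto
    then show False using that s(3)[of i] unfolding \<beta>'_Suc by linarith
  qed
  have \<beta>'_cong: "\<beta>' x = \<beta>' y" if "\<gamma> x = \<gamma> y" for x y
    using that unfolding \<beta>'_def by simp
  \<comment> \<open>The new class \<open>i\<close> is the class \<open>s i\<close> of \<gamma>. Its
    two old halves have the colours \<open>w\<close> names, less one, as \<open>extends\<close> adds
    the \<open>Suc\<close>.\<close>
  define w where "w i = prod_encode (2 * s i, Suc (2 * s i))" for i
  have w: "computable_in {} w" unfolding w_def by (intro computable_intros s)
  have "extends t \<beta> A \<beta>' A' w"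
    unfolding extends_def
  proof (intro conjI allI impI)
    show "pfst (w i) \<noteq> psnd (w i)" for i by (simp add: w_def)
    show "\<beta>' x = Suc i \<longleftrightarrow> \<beta> x = Suc (pfst (w i)) \<or> \<beta> x = Suc (psnd (w i))" for i x
      by (simp add: w_def \<beta>'_Suc \<gamma>_Suc)
    show "A' x \<longleftrightarrow> A x" if "\<beta> x = 0" for x
      using that by (intro A'_0) (simp add: \<gamma>_0)
    show "A' x \<longleftrightarrow> A' y" if "\<beta> x = \<beta> y \<and> \<beta> x \<noteq> 0" for x y
      using that by (intro A'_eq) (simp_all add: \<gamma>_def)
    show "\<beta>' t = 0" by (rule \<beta>'_0) simp
  qed
  moreover have "forces f k \<beta>' A' v q"
    unfolding forces_def \<beta>'_Suc
  proof (intro conjI count)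
    show "(\<exists>x. \<beta>' x = 0 \<and> \<beta>' (f x) = 0 \<and> (A' x \<longleftrightarrow> \<not> A' (f x))) \<or> (\<forall>x. \<beta>' (f x) = \<beta>' x)"
      using rigid \<beta>'_0 \<beta>'_cong by (meson max.coboundedI1)
  qed
  ultimately show ?thesis using \<beta>' A' q w by blast
qed

section \<open>Towers of conditions\<close>

text \<open>The interface between the construction and the study of the degrees: indices, witnesses
  and oracles no longer occur. The point of \<open>count\<close> is that \<open>v\<close> does not
  depend on the class.\<close>

locale tower =
  fixes U :: "nat set" and \<beta> :: "nat \<Rightarrow> nat \<Rightarrow> nat" and A :: "nat \<Rightarrow> nat \<Rightarrow> bool"
  assumes computable_\<beta>: "computable_in {} (\<beta> t)"
    and decidable_A: "decidable_in {} (A t)"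
    and decided: "\<beta> t x = 0 \<Longrightarrow> x \<in> U \<longleftrightarrow> A t x"
    and homogeneous: "\<beta> t x = \<beta> t y \<Longrightarrow> \<beta> t x \<noteq> 0 \<Longrightarrow> x \<in> U \<longleftrightarrow> y \<in> U"
    and merge: "\<exists>j j'. j \<noteq> j' \<and> (\<forall>x. \<beta> (Suc t) x = Suc i \<longleftrightarrow> \<beta> t x = Suc j \<or> \<beta> t x = Suc j')"
    and class_0: "\<exists>x. {x. \<beta> 0 x = Suc i} = {x}"
    and rigid: "computable_in {} f \<Longrightarrow> (\<And>x. x \<in> U \<longleftrightarrow> f x \<in> U) \<Longrightarrow> \<exists>t. \<forall>x. \<beta> t (f x) = \<beta> t x"
    and count: "computable_in {} f \<Longrightarrow> (\<And>y. finite (f -` {y}) \<and> card (f -` {y}) \<le> k) \<Longrightarrow>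
      \<exists>t v. \<forall>i. finite {x. \<beta> t (f x) = Suc i} \<and> card {x. \<beta> t (f x) = Suc i} = v"
    and padding: "\<beta> 0 (3 * n + 1) = 0" "\<beta> 0 (3 * n + 2) = 0" "A 0 (3 * n + 1)" "\<not> A 0 (3 * n + 2)"

section \<open>Coding conditions by indices of computable functions\<close>

abbreviation phi0 :: "nat \<Rightarrow> nat \<Rightarrow> nat" where "phi0 \<equiv> phi {}"

text \<open>A stage is the code \<open>\<langle>p, \<langle>d, \<langle>v, \<langle>q, w\<rangle>\<rangle>\<rangle>\<rangle>\<close> of a condition and its witnesses.\<close>

definition colour :: "nat \<Rightarrow> nat \<Rightarrow> nat" where
  "colour c = phi0 (pfst c)"
definition member :: "nat \<Rightarrow> nat \<Rightarrow> bool" where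
  "member c x \<longleftrightarrow> phi0 (pfst (psnd c)) x \<noteq> 0"
definition wit_v :: "nat \<Rightarrow> nat" where
  "wit_v c = pfst (psnd (psnd c))"
definition wit_q :: "nat \<Rightarrow> nat \<Rightarrow> nat" where
  "wit_q c = phi0 (pfst (psnd (psnd (psnd c))))"
definition wit_w :: "nat \<Rightarrow> nat \<Rightarrow> nat" where
  "wit_w c = phi0 (psnd (psnd (psnd (psnd c))))"

definition total_index :: "nat \<Rightarrow> bool" where
  "total_index e \<longleftrightarrow> (\<forall>x. phi_halts {} e x)"

text \<open>The bound is 2^t, written as a recursion so that its computability is immediate.
  Counting below \<open>b\<close> turns the size of a class into a universal statement.\<close>

definition good :: "nat \<Rightarrow> nat \<Rightarrow> bool" where
  "good t c \<longleftrightarrow> total_index (pfst c) \<and> total_index (pfst (psnd c)) \<and>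
    (\<forall>i b. card {x. x < b \<and> colour c x = Suc i} \<le> rec_nat 1 (\<lambda>_ r. 2 * r) t)"

text \<open>The stage number \<open>t\<close> serves twice: \<open>t\<close> itself becomes decided,
  and as a coded pair of an index and a bound it names the requirement to be met. A partial index
  makes the requirement void.\<close>

definition step :: "nat \<Rightarrow> nat \<Rightarrow> nat \<Rightarrow> bool" where
  "step t c c' \<longleftrightarrow> total_index (pfst c') \<and> total_index (pfst (psnd c')) \<and>
    extends t (colour c) (member c) (colour c') (member c') (wit_w c') \<and>
    (total_index (pfst t) \<longrightarrow>
      forces (phi0 (pfst t)) (psnd t) (colour c') (member c') (wit_v c') (wit_q c'))"

abbreviation (input) zero_jump :: "nat set" where "zero_jump \<equiv> jump {}"

lemma computable_in_phi0:
  "computable_in zero_jump f \<Longrightarrow> computable_in zero_jump g \<Longrightarrow>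
    computable_in zero_jump (\<lambda>x. phi0 (f x) (g x))"
  by (rule computable_in_jump_phi)

lemma decidable_in_total_index:
  "computable_in (jump zero_jump) f \<Longrightarrow> decidable_in (jump zero_jump) (\<lambda>x. total_index (f x))"
  unfolding total_index_def
  by (erule decidable_in_comp[rotated])
    (intro decidable_in_jump_all decidable_in_phi_halts computable_intros)

lemma decidable_in_good: "decidable_in (jump zero_jump) (\<lambda>z. good (pfst z) (psnd z))"
  unfolding good_def colour_def
  by (intro decidable_in_conj decidable_in_total_index decidable_in_jump_all2 computable_intros
      computable_in_phi0 computable_in_rec_nat)

text \<open>The values of \<open>phi0\<close> are computable from the first jump, and each clause
  has a single block of like quantifiers over them, so the second jump decides it.\<close>

lemma decidable_in_step:
  "decidable_in (jump zero_jump) (\<lambda>z. step (pfst z) (pfst (psnd z)) (psnd (psnd z)))"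
  unfolding step_def extends_def forces_def colour_def member_def wit_v_def wit_q_def wit_w_def
  by (intro decidable_in_conj decidable_in_disj decidable_in_imp decidable_in_total_index
      decidable_in_jump_ex decidable_in_jump_all2 decidable_in_jump_all
      decidable_in_jump[of zero_jump] computable_intros computable_in_phi0)

text \<open>The residues 1 and 2 modulo 3 are the infinite computable parts of the set and of its
  complement; the multiples of 3 start as singleton classes.\<close>

definition init_code :: "nat \<Rightarrow> bool" where
  "init_code c \<longleftrightarrow> total_index (pfst c) \<and> total_index (pfst (psnd c)) \<and>
    colour c = (\<lambda>x. if x mod 3 = 0 then Suc (x div 3) else 0) \<and>
    member c = (\<lambda>x. x mod 3 = 1)"

lemma total_phi: "total_index e \<Longrightarrow> computable_in {} (phi0 e)"
  unfolding total_index_def by (rule computable_in_phi) blast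

lemma phi0_complete:
  assumes "computable_in {} f"
  obtains e where "phi0 e = f" "total_index e"
  using computable_in_phiE[OF assms] unfolding total_index_def by metis

lemma init_code_exists: "\<exists>c. init_code c"
proof -
  have "computable_in {} (\<lambda>x. if x mod 3 = 0 then Suc (x div 3) else 0)"
    by (intro computable_intros) auto
  then obtain p where p: "phi0 p = (\<lambda>x. if x mod 3 = 0 then Suc (x div 3) else 0)" "total_index p"
    by (rule phi0_complete)
  have "decidable_in {} (\<lambda>x. x mod 3 = 1)"
    by (intro computable_intros) auto
  then obtain d where d: "phi0 d = (\<lambda>x. of_bool (x mod 3 = 1))" "total_index d"
    unfolding decidable_in_def by (rule phi0_complete)
  have "init_code (prod_encode (p, prod_encode (d, 0)))"
    unfolding init_code_def colour_def member_def using p d by auto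
  then show ?thesis by blast
qed

lemma two_pow: "rec_nat 1 (\<lambda>_ r. 2 * r) t = (2::nat) ^ t"
  by (induction t) auto

text \<open>Every finite subset lies below some \<open>b\<close>, so finite subsets have bounded
  size.\<close>

lemma finite_card_if_bounded:
  fixes P :: "nat \<Rightarrow> bool"
  assumes "\<And>b. card {x. x < b \<and> P x} \<le> L"
  shows "finite {x. P x} \<and> card {x. P x} \<le> L"
proof -
  have "card F \<le> L" if F: "F \<subseteq> {x. P x}" "finite F" for F
  proof -
    obtain b where "F \<subseteq> {..<b}" using F(2) by (metis finite_nat_iff_bounded)
    then have "card F \<le> card {x. x < b \<and> P x}" using F(1) by (intro card_mono) auto
    then show ?thesis using assms le_trans by blast
  qed
  then show ?thesis
    by (metis finite_if_finite_subsets_card_bdd order_refl)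
qed

lemma step_exists:
  assumes "good t c"
  shows "\<exists>c'. step t c c'"
proof -
  have "finite {x. colour c x = Suc i}" "card {x. colour c x = Suc i} \<le> 2 ^ t" for i
    using assms finite_card_if_bounded[of "\<lambda>x. colour c x = Suc i" "2 ^ t"]
    unfolding good_def two_pow by blast+
  moreover have colour: "computable_in {} (colour c)"
    using assms total_phi unfolding good_def colour_def by blast
  moreover have "computable_in {} (phi0 (pfst (psnd c)))"
    using assms total_phi unfolding good_def by blast
  then have "decidable_in {} (member c)"
    unfolding member_def by (intro computable_intros)
  \<comment> \<open>For a partial index the identity is a harmless stand-in, as then
    \<open>step\<close> imposes no requirement on \<open>f\<close>.\<close>
  moreover have "computable_in {} (if total_index (pfst t) then phi0 (pfst t) else (\<lambda>x. x))"
    using total_phi computable_in_id by simp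
  ultimately obtain \<beta>' A' v q w where ext: "computable_in {} \<beta>'" "decidable_in {} A'"
    "computable_in {} q" "computable_in {} w" "extends t (colour c) (member c) \<beta>' A' w"
    "forces (if total_index (pfst t) then phi0 (pfst t) else (\<lambda>x. x)) (psnd t) \<beta>' A' v q"
    using extension_exists[of "colour c" "member c" _ "2 ^ t" t "psnd t"] by blast
  obtain p where p: "phi0 p = \<beta>'" "total_index p" using ext(1) by (rule phi0_complete)
  obtain d where d: "phi0 d = (\<lambda>x. of_bool (A' x))" "total_index d"
    using ext(2) unfolding decidable_in_def by (rule phi0_complete)
  obtain q' where q: "phi0 q' = q" using ext(3) by (rule phi0_complete)
  obtain w' where w: "phi0 w' = w" using ext(4) by (rule phi0_complete)
  define c' where "c' = prod_encode (p, prod_encode (d, prod_encode (v, prod_encode (q', w'))))"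
  have "colour c' = \<beta>'" "member c' = A'" "wit_v c' = v" "wit_q c' = q" "wit_w c' = w"
    by (auto simp: c'_def colour_def member_def wit_v_def wit_q_def wit_w_def p d q w)
  then have "step t c c'"
    unfolding step_def using ext(5,6) p(2) d(2) by (auto simp: c'_def)
  then show ?thesis by blast
qed

section \<open>The sequence of conditions, computed from the double jump\<close>

primrec stage :: "nat \<Rightarrow> nat" where
  "stage 0 = (SOME c. init_code c)"
| "stage (Suc t) = (LEAST c'. good t (stage t) \<longrightarrow> step t (stage t) c')"

declare stage.simps [simp del]

lemma init_stage: "init_code (stage 0)"
  unfolding stage.simps by (rule someI_ex[OF init_code_exists])

text \<open>The guard \<open>good\<close> in the search makes it total for all arguments, not just
  along the sequence. The initial code enters as a constant, so its choice need not be
  effective.\<close>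

lemma computable_in_stage: "computable_in (jump zero_jump) stage"
proof -
  have least: "computable_in (jump zero_jump)
      (\<lambda>z. LEAST c'. good (pfst z) (psnd z) \<longrightarrow> step (pfst z) (psnd z) c')"
  proof (rule computable_in_Least)
    show "\<exists>c'. good (pfst z) (psnd z) \<longrightarrow> step (pfst z) (psnd z) c'" for z
      using step_exists by blast
    show "decidable_in (jump zero_jump) (\<lambda>z. good (pfst (pfst z)) (psnd (pfst z)) \<longrightarrow>
        step (pfst (pfst z)) (psnd (pfst z)) (psnd z))"
      by (intro decidable_in_imp decidable_in_comp2[OF decidable_in_good]
          decidable_in_comp3[OF decidable_in_step] computable_intros)
  qed
  have "computable_in (jump zero_jump) (\<lambda>t. rec_nat (stage 0)
      (\<lambda>n r. LEAST c'. good n r \<longrightarrow> step n r c') t)"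
    by (intro computable_in_rec_nat computable_in_const computable_in_id
        computable_in_comp2[where F = "\<lambda>n r. LEAST c'. good n r \<longrightarrow> step n r c'", OF least]
        computable_in_pfst computable_in_psnd)
  moreover have "rec_nat (stage 0) (\<lambda>n r. LEAST c'. good n r \<longrightarrow> step n r c') t = stage t" for t
    by (induction t) (simp_all add: stage.simps)
  ultimately show ?thesis by simp
qed

section \<open>Invariants along the sequence, and the limit set\<close>

lemma extends_class_split:
  assumes "extends t \<beta> A \<beta>' A' w"
  shows "{x. \<beta>' x = Suc i} = {x. \<beta> x = Suc (pfst (w i))} \<union> {x. \<beta> x = Suc (psnd (w i))}"
  using assms unfolding extends_def by blast

lemma extends_decided:
  assumes "extends t \<beta> A \<beta>' A' w" "\<beta> x = 0"
  shows "\<beta>' x = 0" "A' x \<longleftrightarrow> A x"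
proof -
  show "\<beta>' x = 0"
    using assms unfolding extends_def by (metis nat.distinct(1) not0_implies_Suc)
  show "A' x \<longleftrightarrow> A x" using assms unfolding extends_def by blast
qed

lemma extends_cong:
  assumes "extends t \<beta> A \<beta>' A' w" "\<beta> x = \<beta> y"
  shows "\<beta>' x = \<beta>' y"
proof -
  have "\<beta>' x = Suc i \<longleftrightarrow> \<beta>' y = Suc i" for i
    using assms unfolding extends_def by simp
  then show ?thesis by (metis not0_implies_Suc)
qed

lemma step_good:
  assumes "good t c" "step t c c'"
  shows "good (Suc t) c'"
proof -
  have "card {x. x < b \<and> colour c' x = Suc i} \<le> 2 ^ Suc t" for i b
  proof -
    let ?w = "wit_w c' i"
    have ext: "extends t (colour c) (member c) (colour c') (member c') (wit_w c')"
      using assms(2) unfolding step_def by blast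
    have "{x. x < b \<and> colour c' x = Suc i} =
        {x. x < b \<and> colour c x = Suc (pfst ?w)} \<union> {x. x < b \<and> colour c x = Suc (psnd ?w)}"
      using extends_class_split[OF ext, of i] by blast
    then have "card {x. x < b \<and> colour c' x = Suc i} \<le>
        card {x. x < b \<and> colour c x = Suc (pfst ?w)} + card {x. x < b \<and> colour c x = Suc (psnd ?w)}"
      by (simp add: card_Un_le)
    moreover have "card {x. x < b \<and> colour c x = Suc j} \<le> 2 ^ t" for j
      using assms(1) unfolding good_def two_pow by blast
    note this[of "pfst ?w"] this[of "psnd ?w"]
    ultimately show ?thesis by simp
  qed
  then show ?thesis using assms(2) unfolding good_def step_def two_pow by blast
qed

lemma init_good: "init_code c \<Longrightarrow> good 0 c"
proof -
  assume c: "init_code c"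
  have "card {x. x < b \<and> colour c x = Suc i} \<le> card {3 * i}" for b i
    using c unfolding init_code_def by (intro card_mono) (auto split: if_splits)
  then show ?thesis using c unfolding good_def init_code_def by simp
qed

lemma good_stage: "good t (stage t)" and step_stage: "step t (stage t) (stage (Suc t))"
proof -
  have step: "step t (stage t) (stage (Suc t))" if "good t (stage t)" for t
    using LeastI_ex[of "\<lambda>c'. good t (stage t) \<longrightarrow> step t (stage t) c'"] step_exists that by (auto simp: stage.simps)
  have good: "good t (stage t)" for t
    by (induction t) (use step step_good init_good[OF init_stage] in blast)+
  show "good t (stage t)" "step t (stage t) (stage (Suc t))" using good step by blast+
qed

lemma extends_stage: "extends t (colour (stage t)) (member (stage t)) (colour (stage (Suc t)))
    (member (stage (Suc t))) (wit_w (stage (Suc t)))"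
  using step_stage[of t] unfolding step_def by blast

lemma decided_mono:
  assumes "s \<le> t" "colour (stage s) x = 0"
  shows "colour (stage t) x = 0 \<and> (member (stage t) x \<longleftrightarrow> member (stage s) x)"
  using assms(1)
proof (induction rule: dec_induct)
  case (step t)
  then show ?case using extends_decided[OF extends_stage, of t x] by blast
qed (use assms in simp)

lemma colour_cong_mono:
  assumes "s \<le> t" "colour (stage s) x = colour (stage s) y"
  shows "colour (stage t) x = colour (stage t) y"
  using assms(1)
  by (induction rule: dec_induct) (use assms(2) extends_cong[OF extends_stage] in blast)+

lemma decided_stage: "colour (stage (Suc x)) x = 0"
  using extends_stage[of x] unfolding extends_def by blast

text \<open>Step \<open>x\<close> decides the number \<open>x\<close>, so stage \<open>Suc x\<close>
  knows its membership.\<close>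

definition limit_set :: "nat set" where
  "limit_set = {x. member (stage (Suc x)) x}"

lemma limit_set_decided:
  assumes "colour (stage t) x = 0"
  shows "x \<in> limit_set \<longleftrightarrow> member (stage t) x"
proof -
  have "member (stage (max t (Suc x))) x \<longleftrightarrow> member (stage t) x"
    using decided_mono[OF _ assms, of "max t (Suc x)"] by simp
  moreover have "member (stage (max t (Suc x))) x \<longleftrightarrow> member (stage (Suc x)) x"
    using decided_mono[OF _ decided_stage, of _ "max t (Suc x)"] by simp
  ultimately show ?thesis unfolding limit_set_def by simp
qed

text \<open>Just before \<open>x\<close> becomes decided, \<open>x\<close> and \<open>y\<close>
  still share a nonzero colour, and the next extension decides that class as a whole.\<close>

lemma limit_set_homogeneous:
  assumes "colour (stage t) x = colour (stage t) y" "colour (stage t) x \<noteq> 0"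
  shows "x \<in> limit_set \<longleftrightarrow> y \<in> limit_set"
proof -
  define s where "s = (LEAST s. colour (stage s) x = 0)"
  have s0: "colour (stage s) x = 0"
    unfolding s_def by (rule LeastI[of _ "Suc x"]) (rule decided_stage)
  have "t < s" using decided_mono[OF _ s0, of t] assms(2) by (metis not_less)
  then obtain r where r: "s = Suc r" "t \<le> r" by (cases s) auto
  have "colour (stage r) x \<noteq> 0" 
    using not_less_Least[of r "\<lambda>s. colour (stage s) x = 0"] r(1) unfolding s_def by simp
  moreover have eq: "colour (stage r) x = colour (stage r) y"
    using colour_cong_mono[OF r(2) assms(1)] .
  ultimately have "member (stage s) x \<longleftrightarrow> member (stage s) y"
    using extends_stage[of r] r(1) unfolding extends_def by blast
  moreover have "colour (stage s) y = 0"
    using extends_cong[OF extends_stage eq] s0 r(1) by simp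
  ultimately show ?thesis using limit_set_decided s0 by simp
qed

lemma turing_le_limit_set: "limit_set \<le>\<^sub>T jump zero_jump"
proof -
  have phi0_jump: "computable_in (jump zero_jump) (\<lambda>z. phi0 (pfst z) (psnd z))"
    by (intro computable_in_jump[of zero_jump] computable_in_phi0 computable_intros)
  have "decidable_in (jump zero_jump) (\<lambda>x. phi0 (pfst (psnd (stage (Suc x)))) x \<noteq> 0)"
    by (intro computable_intros computable_in_comp2[OF phi0_jump]
        computable_in_comp[OF computable_in_stage])
  moreover have "char_fun limit_set = (\<lambda>x. of_bool (phi0 (pfst (psnd (stage (Suc x)))) x \<noteq> 0))"
    unfolding char_fun_def limit_set_def member_def by auto
  ultimately show ?thesis unfolding turing_le_def decidable_in_def by simp
qed

text \<open>The requirement for index \<open>e\<close> and bound \<open>k\<close> is met in the step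
  whose number is the code of that pair.\<close>

lemma forces_stage:
  assumes "computable_in {} f"
  shows "\<exists>t. forces f k (colour (stage t)) (member (stage t)) (wit_v (stage t)) (wit_q (stage t))"
proof -
  obtain e where e: "phi0 e = f" "total_index e" using assms by (rule phi0_complete)
  show ?thesis
    using step_stage[of "prod_encode (e, k)"] e unfolding step_def prod_encode_inverse fst_conv snd_conv
    by blast
qed

lemma tower_limit_set: "tower limit_set (\<lambda>t. colour (stage t)) (\<lambda>t. member (stage t))"
proof
  fix t
  show "computable_in {} (colour (stage t))"
    using good_stage[of t] total_phi unfolding good_def colour_def by blast
  have "computable_in {} (phi0 (pfst (psnd (stage t))))"
    using good_stage[of t] total_phi unfolding good_def by blast
  then show "decidable_in {} (member (stage t))"
    unfolding member_def by (intro computable_intros)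
next
  fix t i
  show "\<exists>j j'. j \<noteq> j' \<and> (\<forall>x. colour (stage (Suc t)) x = Suc i \<longleftrightarrow>
      colour (stage t) x = Suc j \<or> colour (stage t) x = Suc j')"
    using extends_stage[of t] unfolding extends_def by blast
next
  fix i
  have "{x. colour (stage 0) x = Suc i} = {3 * i}"
    using init_stage unfolding init_code_def by (auto split: if_splits)
  then show "\<exists>x. {x. colour (stage 0) x = Suc i} = {x}" by blast
next
  fix f
  assume f: "computable_in {} f" "\<And>x. x \<in> limit_set \<longleftrightarrow> f x \<in> limit_set"
  obtain t where "forces f 0 (colour (stage t)) (member (stage t)) (wit_v (stage t)) (wit_q (stage t))"
    using forces_stage[OF f(1)] by blast
  \<comment> \<open>The other alternative of \<open>forces\<close>, a decided disagreement,
    contradicts that \<open>f\<close> is a self-reduction.\<close>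
  moreover have "member (stage t) x \<longleftrightarrow> member (stage t) (f x)"
    if "colour (stage t) x = 0" "colour (stage t) (f x) = 0" for x
    using that f(2) limit_set_decided by blast
  ultimately show "\<exists>t. \<forall>x. colour (stage t) (f x) = colour (stage t) x"
    unfolding forces_def by blast
next
  fix f k
  assume f: "computable_in {} f" "\<And>y. finite (f -` {y}) \<and> card (f -` {y}) \<le> k"
  obtain t where t: "forces f k (colour (stage t)) (member (stage t)) (wit_v (stage t)) (wit_q (stage t))"
    using forces_stage[OF f(1)] by blast
  let ?c = "\<lambda>b i. card {x. x < b \<and> colour (stage t) (f x) = Suc i}"
  have "card {x. x < b \<and> f x = y} \<le> k" for y b
  proof -
    have "card {x. x < b \<and> f x = y} \<le> card (f -` {y})"
      using f(2) by (intro card_mono) auto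
    then show ?thesis using f(2)[of y] by simp
  qed
  then have v: "?c b i = wit_v (stage t)" if "wit_q (stage t) i \<le> b" for i b
    using t that unfolding forces_def by blast
  have "finite {x. colour (stage t) (f x) = Suc i} \<and>
      card {x. colour (stage t) (f x) = Suc i} = wit_v (stage t)" for i
  proof -
    \<comment> \<open>Counts grow with \<open>b\<close> and equal the witness from the modulus on,
      so raising \<open>b\<close> to the modulus bounds all of them.\<close>
    have "?c b i \<le> wit_v (stage t)" for b
      using card_bounded_mono[of b "max b (wit_q (stage t) i)" "\<lambda>x. colour (stage t) (f x) = Suc i"]
        v[of i "max b (wit_q (stage t) i)"]
      by simp
    then have "finite {x. colour (stage t) (f x) = Suc i} \<and>
        card {x. colour (stage t) (f x) = Suc i} \<le> wit_v (stage t)"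
      by (rule finite_card_if_bounded)
    moreover from this have "?c (wit_q (stage t) i) i \<le> card {x. colour (stage t) (f x) = Suc i}"
      by (intro card_mono) auto
    ultimately show ?thesis using v[of i "wit_q (stage t) i"] by simp
  qed
  then show "\<exists>t v. \<forall>i. finite {x. colour (stage t) (f x) = Suc i} \<and>
      card {x. colour (stage t) (f x) = Suc i} = v"
    by blast
next
  fix n :: nat
  have "(3 * n + 1) mod 3 = 1" "(3 * n + 2) mod 3 = 2" by presburger+
  then show "colour (stage 0) (3 * n + 1) = 0" "colour (stage 0) (3 * n + 2) = 0"
    "member (stage 0) (3 * n + 1)" "\<not> member (stage 0) (3 * n + 2)"
    using init_stage unfolding init_code_def by simp_all
qed (fact limit_set_decided limit_set_homogeneous)+

section \<open>Colour classes of constant size\<close>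

text \<open>Colour and rank are computable coordinates for the points of nonzero colour;
  \<open>class_nth\<close> is the inverse.\<close>

definition rank :: "(nat \<Rightarrow> nat) \<Rightarrow> nat \<Rightarrow> nat" where
  "rank \<kappa> y = card {z. z < y \<and> \<kappa> z = \<kappa> y}"

text \<open>The last two disjuncts only serve to make the search total.\<close>

definition class_nth :: "(nat \<Rightarrow> nat) \<Rightarrow> nat \<Rightarrow> nat \<Rightarrow> nat \<Rightarrow> nat" where
  "class_nth \<kappa> v c j = (LEAST y. (\<kappa> y = c \<and> rank \<kappa> y = j) \<or> c = 0 \<or> v \<le> j)"

definition classes_of_size :: "(nat \<Rightarrow> nat) \<Rightarrow> nat \<Rightarrow> bool" where
  "classes_of_size \<kappa> v \<longleftrightarrow> (\<forall>i. finite {x. \<kappa> x = Suc i} \<and> card {x. \<kappa> x = Suc i} = v)"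

lemma rank_strict_mono: "\<kappa> y = \<kappa> y' \<Longrightarrow> y < y' \<Longrightarrow> rank \<kappa> y < rank \<kappa> y'"
  unfolding rank_def by (intro psubset_card_mono) auto

lemma rank_inj: "\<kappa> y = \<kappa> y' \<Longrightarrow> rank \<kappa> y = rank \<kappa> y' \<Longrightarrow> y = y'"
  using rank_strict_mono[of \<kappa> y y'] rank_strict_mono[of \<kappa> y' y]
  by (cases y y' rule: linorder_cases) auto

lemma classes_of_sizeD:
  assumes "classes_of_size \<kappa> v" "c \<noteq> 0"
  shows "finite {x. \<kappa> x = c}" "card {x. \<kappa> x = c} = v"
  using assms unfolding classes_of_size_def by (metis not0_implies_Suc)+

lemma rank_less:
  assumes "classes_of_size \<kappa> v" "\<kappa> y \<noteq> 0"
  shows "rank \<kappa> y < v"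
proof -
  have "rank \<kappa> y < card {x. \<kappa> x = \<kappa> y}"
    unfolding rank_def by (intro psubset_card_mono classes_of_sizeD[OF assms]) auto
  then show ?thesis using classes_of_sizeD(2)[OF assms] by simp
qed

text \<open>The \<open>v\<close> points of a class have distinct ranks below \<open>v\<close>, so
  every such rank occurs.\<close>

lemma class_nth_exists:
  assumes v: "classes_of_size \<kappa> v" and "c \<noteq> 0" "j < v"
  shows "\<exists>y. \<kappa> y = c \<and> rank \<kappa> y = j"
proof -
  let ?C = "{x. \<kappa> x = c}"
  have "inj_on (rank \<kappa>) ?C" by (rule inj_onI) (metis (mono_tags) mem_Collect_eq rank_inj)
  then have "card (rank \<kappa> ` ?C) = v"
    using classes_of_sizeD(2)[OF v \<open>c \<noteq> 0\<close>] by (simp add: card_image)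
  moreover have "rank \<kappa> ` ?C \<subseteq> {..<v}" using rank_less[OF v] \<open>c \<noteq> 0\<close> by auto
  ultimately have "rank \<kappa> ` ?C = {..<v}" by (intro card_subset_eq) auto
  then have "j \<in> rank \<kappa> ` ?C" using \<open>j < v\<close> by simp
  then show ?thesis by blast
qed

lemma class_nth:
  assumes "classes_of_size \<kappa> v" "c \<noteq> 0" "j < v"
  shows "\<kappa> (class_nth \<kappa> v c j) = c" "rank \<kappa> (class_nth \<kappa> v c j) = j"
proof -
  have "\<exists>y. (\<kappa> y = c \<and> rank \<kappa> y = j) \<or> c = 0 \<or> v \<le> j"
    using class_nth_exists[OF assms] by blast
  from LeastI_ex[OF this]
  show "\<kappa> (class_nth \<kappa> v c j) = c" "rank \<kappa> (class_nth \<kappa> v c j) = j"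
    unfolding class_nth_def using assms(2,3) by auto
qed

lemma class_nth_rank:
  assumes "classes_of_size \<kappa> v" "\<kappa> y \<noteq> 0"
  shows "class_nth \<kappa> v (\<kappa> y) (rank \<kappa> y) = y"
  by (rule rank_inj[of \<kappa>]) (simp_all only: class_nth[OF assms rank_less[OF assms]])

lemma computable_in_rank:
  assumes "computable_in X \<kappa>"
  shows "computable_in X (rank \<kappa>)"
  unfolding rank_def by (intro computable_intros computable_in_comp[OF assms])

lemma computable_in_class_nth:
  assumes "computable_in X \<kappa>" "classes_of_size \<kappa> v"
  shows "computable_in X (\<lambda>z. class_nth \<kappa> v (pfst z) (psnd z))"
  unfolding class_nth_def
proof (rule computable_in_Least)
  show "\<exists>y. (\<kappa> y = pfst z \<and> rank \<kappa> y = psnd z) \<or> pfst z = 0 \<or> v \<le> psnd z" for z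
    using class_nth_exists[OF assms(2)] by (meson not_le)
  show "decidable_in X (\<lambda>z. (\<kappa> (psnd z) = pfst (pfst z) \<and> rank \<kappa> (psnd z) = psnd (pfst z)) \<or>
      pfst (pfst z) = 0 \<or> v \<le> psnd (pfst z))"
    by (intro computable_intros computable_in_comp[OF computable_in_rank]
        computable_in_comp[OF assms(1)] assms(1))
qed

lemma classes_of_size_merge:
  assumes "classes_of_size \<kappa> v"
    and "\<And>i. \<exists>j j'. j \<noteq> j' \<and> (\<forall>x. \<kappa>' x = Suc i \<longleftrightarrow> \<kappa> x = Suc j \<or> \<kappa> x = Suc j')"
  shows "classes_of_size \<kappa>' (v * 2)"
  unfolding classes_of_size_def
proof
  fix i
  obtain j j' where "j \<noteq> j'" and j: "\<And>x. \<kappa>' x = Suc i \<longleftrightarrow> \<kappa> x = Suc j \<or> \<kappa> x = Suc j'"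
    using assms(2) by blast
  have "{x. \<kappa>' x = Suc i} = {x. \<kappa> x = Suc j} \<union> {x. \<kappa> x = Suc j'}" using j by blast
  moreover have "card ({x. \<kappa> x = Suc j} \<union> {x. \<kappa> x = Suc j'}) =
      card {x. \<kappa> x = Suc j} + card {x. \<kappa> x = Suc j'}"
    using assms(1) \<open>j \<noteq> j'\<close> unfolding classes_of_size_def by (intro card_Un_disjoint) auto
  ultimately show "finite {x. \<kappa>' x = Suc i} \<and> card {x. \<kappa>' x = Suc i} = v * 2"
    using assms(1) unfolding classes_of_size_def by simp
qed

text \<open>An increasing search through the range removes repetitions, so a function that is merely
  finite-one still supplies an injective one.\<close>

lemma computable_injection_into_infinite_range:
  assumes g: "computable_in X g" and inf: "infinite (range g)"
  obtains r where "computable_in X r" "inj r" "range r \<subseteq> range g"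
proof -
  have "\<exists>n>m. \<exists>b. g b = n" for m
    using inf unfolding infinite_nat_iff_unbounded by blast
  moreover have "decidable_in X (\<lambda>z. g (psnd z) = pfst z)"
    by (intro computable_intros computable_in_comp[OF g])
  ultimately obtain r where r: "computable_in X r" "strict_mono r" "\<And>n. \<exists>b. g b = r n"
    using computable_selection[of X "\<lambda>n b. g b = n" 0] by blast
  have "range r \<subseteq> range g" using r(3) by (metis image_subsetI rangeI)
  then show ?thesis using that r(1) strict_mono_imp_inj_on[OF r(2)] by blast
qed

section \<open>Representations\<close>

context tower
begin

lemma merge_cong: "\<beta> t x = \<beta> t y \<Longrightarrow> \<beta> (Suc t) x = \<beta> (Suc t) y"
proof -
  assume eq: "\<beta> t x = \<beta> t y"
  have "\<beta> (Suc t) x = Suc i \<longleftrightarrow> \<beta> (Suc t) y = Suc i" for i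
  proof -
    obtain j j' where "\<And>x. \<beta> (Suc t) x = Suc i \<longleftrightarrow> \<beta> t x = Suc j \<or> \<beta> t x = Suc j'"
      using merge[of t i] by blast
    then show ?thesis by (simp only: eq)
  qed
  then show ?thesis by (metis not0_implies_Suc)
qed

lemma merge_0: "\<beta> t x = 0 \<Longrightarrow> \<beta> (Suc t) x = 0"
proof (rule ccontr)
  assume "\<beta> t x = 0" "\<beta> (Suc t) x \<noteq> 0"
  moreover from this obtain i where "\<beta> (Suc t) x = Suc i" using not0_implies_Suc by blast
  ultimately show False using merge[of t i] by auto
qed

lemma decided_mono: "s \<le> t \<Longrightarrow> \<beta> s x = 0 \<Longrightarrow> \<beta> t x = 0"
  by (induction rule: dec_induct) (auto intro: merge_0)

lemma padding_in: "\<beta> t (3 * n + 1) = 0" "3 * n + 1 \<in> U"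
  using decided_mono[OF le0 padding(1)] decided[OF padding(1)] padding(3) by auto

lemma padding_out: "\<beta> t (3 * n + 2) = 0" "3 * n + 2 \<notin> U"
  using decided_mono[OF le0 padding(2)] decided[OF padding(2)] padding(4) by auto

lemma rigid_mono:
  assumes "s \<le> t" "\<forall>x. \<beta> s (g x) = \<beta> s x"
  shows "\<forall>x. \<beta> t (g x) = \<beta> t x"
  using assms by (induction rule: dec_induct) (auto intro: merge_cong)

lemma class_size: "classes_of_size (\<beta> t) (2 ^ t)"
proof (induction t)
  case 0
  show ?case
    unfolding classes_of_size_def
  proof
    fix i
    obtain x where "{x. \<beta> 0 x = Suc i} = {x}" using class_0 by blast
    then show "finite {x. \<beta> 0 x = Suc i} \<and> card {x. \<beta> 0 x = Suc i} = 2 ^ 0" by simp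
  qed
next
  case (Suc t)
  show ?case using classes_of_size_merge[OF Suc merge] by (simp add: mult.commute)
qed

lemma class_nonempty: "\<exists>x. \<beta> t x = Suc i"
proof -
  have "card {x. \<beta> t x = Suc i} \<noteq> 0"
    using class_size[of t] unfolding classes_of_size_def by simp
  then show ?thesis by (metis (mono_tags, lifting) card.empty empty_Collect_eq)
qed

text \<open>Were \<open>U\<close> computable, sending members to 1 and non-members to 2 would be a
  self-reduction. Both values are decided, so it changes the colour of every undecided point,
  against rigidity.\<close>

lemma not_computable: "\<not> computable_set U"
proof
  assume "computable_set U"
  then have "computable_in {} (char_fun U)" unfolding computable_set_def computable_def .
  then have "computable_in {} (\<lambda>x. if char_fun U x = 1 then 1 else 2)"
    by (intro computable_intros)
  moreover have "x \<in> U \<longleftrightarrow> (if char_fun U x = 1 then 1 else 2) \<in> U" for x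
    using padding_in(2)[of 0, unfolded mult_0_right add_0] padding_out(2)[of 0, unfolded mult_0_right add_0]
    by (auto simp: char_fun_def)
  ultimately obtain t where t: "\<And>x. \<beta> t (if char_fun U x = 1 then 1 else 2) = \<beta> t x"
    using rigid by blast
  obtain x where "\<beta> t x = Suc 0" using class_nonempty by blast
  then show False
    using t[of x] padding_in(1)[of t 0, unfolded mult_0_right add_0]
      padding_out(1)[of t 0, unfolded mult_0_right add_0]
    by (auto split: if_splits)
qed

text \<open>
  The elements of \<open>B\<close> with decided image carry no weight; \<open>r1\<close> and \<open>r0\<close> provide room for their
  counterparts in other sets.
\<close>

definition rep_via :: "(nat \<Rightarrow> nat) \<Rightarrow> (nat \<Rightarrow> nat) \<Rightarrow> (nat \<Rightarrow> nat) \<Rightarrow> nat set \<Rightarrow> nat \<Rightarrow> nat \<Rightarrow> bool" where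
  "rep_via f r1 r0 B t v \<longleftrightarrow> computable_in {} f \<and> (\<forall>b. b \<in> B \<longleftrightarrow> f b \<in> U) \<and>
    classes_of_size (\<lambda>b. \<beta> t (f b)) v \<and>
    computable_in {} r1 \<and> inj r1 \<and> (\<forall>n. r1 n \<in> B \<and> \<beta> t (f (r1 n)) = 0) \<and>
    computable_in {} r0 \<and> inj r0 \<and> (\<forall>n. r0 n \<notin> B \<and> \<beta> t (f (r0 n)) = 0)"

definition rep :: "nat set \<Rightarrow> nat \<Rightarrow> nat \<Rightarrow> bool" where
  "rep B t v \<longleftrightarrow> (\<exists>f r1 r0. rep_via f r1 r0 B t v)"

lemma classes_of_size_add:
  assumes "classes_of_size (\<lambda>b. \<beta> t (f b)) v"
  shows "classes_of_size (\<lambda>b. \<beta> (t + n) (f b)) (v * 2 ^ n)"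
proof (induction n)
  case (Suc n)
  then have "classes_of_size (\<lambda>b. \<beta> (Suc (t + n)) (f b)) (v * 2 ^ n * 2)"
    by (rule classes_of_size_merge) (use merge in blast)
  then show ?case by (simp add: ac_simps)
qed (use assms in simp)

lemma rep_via_add: "rep_via f r1 r0 B t v \<Longrightarrow> rep_via f r1 r0 B (t + n) (v * 2 ^ n)"
  unfolding rep_via_def using classes_of_size_add decided_mono[OF le_add1] by blast

text \<open>Each merge doubles the class sizes, so \<open>v / 2 ^ t\<close> is unchanged. This
  brings two representations to a common stage.\<close>

lemma rep_add: "rep B t v \<Longrightarrow> rep B (t + n) (v * 2 ^ n)"
  unfolding rep_def using rep_via_add by blast

text \<open>A point is sent to the point with the same colour and rank, which exists because
  \<open>v \<le> v'\<close>. Points with decided image go to \<open>r1\<close> or \<open>r0\<close>,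
  as \<open>A t\<close> directs.\<close>

lemma rep_one_le:
  assumes B: "rep B t v" and B': "rep B' t v'" and "v \<le> v'"
  shows "B \<le>\<^sub>1 B'"
proof -
  obtain f r1 r0 where f: "computable_in {} f" "\<And>b. b \<in> B \<longleftrightarrow> f b \<in> U"
    "classes_of_size (\<lambda>b. \<beta> t (f b)) v"
    using B unfolding rep_def rep_via_def by blast
  obtain f' r1 r0 where f': "computable_in {} f'" "\<And>b. b \<in> B' \<longleftrightarrow> f' b \<in> U"
    "classes_of_size (\<lambda>b. \<beta> t (f' b)) v'"
    and r1: "computable_in {} r1" "inj r1" "\<And>n. r1 n \<in> B'" "\<And>n. \<beta> t (f' (r1 n)) = 0"
    and r0: "computable_in {} r0" "inj r0" "\<And>n. r0 n \<notin> B'" "\<And>n. \<beta> t (f' (r0 n)) = 0"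
    using B' unfolding rep_def rep_via_def by blast
  define \<kappa> where "\<kappa> b = \<beta> t (f b)" for b
  define \<kappa>' where "\<kappa>' b = \<beta> t (f' b)" for b
  have \<kappa>: "computable_in {} \<kappa>" "classes_of_size \<kappa> v"
    using f computable_in_comp[OF computable_\<beta>] unfolding \<kappa>_def by blast+
  have \<kappa>': "computable_in {} \<kappa>'" "classes_of_size \<kappa>' v'"
    using f' computable_in_comp[OF computable_\<beta>] unfolding \<kappa>'_def by blast+
  define h where "h b = (if \<kappa> b \<noteq> 0 then class_nth \<kappa>' v' (\<kappa> b) (rank \<kappa> b)
    else if A t (f b) then r1 b else r0 b)" for b
  have "computable_in {} h"
    unfolding h_def
    by (intro computable_in_if computable_intros decidable_in_comp[OF decidable_A] f(1) r1(1) r0(1)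
        computable_in_comp2[OF computable_in_class_nth[OF \<kappa>']] \<kappa> computable_in_rank)
  moreover have main: "\<kappa>' (h b) = \<kappa> b" "rank \<kappa>' (h b) = rank \<kappa> b" if "\<kappa> b \<noteq> 0" for b
    using class_nth[OF \<kappa>'(2) that] rank_less[OF \<kappa>(2) that] \<open>v \<le> v'\<close> that
    unfolding h_def by auto
  have "b \<in> B \<longleftrightarrow> h b \<in> B'" for b
  proof (cases "\<kappa> b = 0")
    case True
    then show ?thesis
      using decided[of t "f b"] r1(3) r0(3) unfolding f(2) h_def by (simp add: \<kappa>_def)
  next
    case False
    from main(1)[OF this] False show ?thesis
      unfolding f(2) f'(2) \<kappa>_def \<kappa>'_def by (metis homogeneous)
  qed
  moreover have "inj h"
  proof (rule injI)
    fix b b' assume eq: "h b = h b'"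
    \<comment> \<open>Decided points land on decided ones, so the branches of \<open>h\<close>
      cannot collide; \<open>r1\<close> and \<open>r0\<close> cannot either, one lying inside
      \<open>B'\<close> and the other outside.\<close>
    have trash: "\<kappa>' (h b) = 0" if "\<kappa> b = 0" for b
      using that r1(4) r0(4) unfolding h_def \<kappa>'_def by simp
    show "b = b'"
    proof (cases "\<kappa> b = 0")
      case True
      then have "\<kappa> b' = 0" using trash[of b] main(1)[of b'] eq by metis
      then show ?thesis
        using eq True r1(2,3) r0(2,3) unfolding h_def by (auto split: if_splits dest: injD) (metis)+
    next
      case False
      then have "\<kappa> b' \<noteq> 0" using trash[of b'] main(1)[of b] eq by metis
      then show ?thesis using main False eq by (metis rank_inj)
    qed
  qed
  ultimately show ?thesis
    unfolding one_le_def many_one_reduction_def computable_def by blast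
qed

text \<open>
  A one-one reduction \<open>g\<close> of \<open>B\<close> to \<open>B'\<close> yields \<open>v\<close> self-reductions of \<open>U\<close>, one for each rank.
  They preserve the colours of a late stage, so \<open>g\<close> preserves them too, and counting applies.
\<close>

lemma one_le_rep:
  assumes B: "rep B t v" and B': "rep B' t v'" and "B \<le>\<^sub>1 B'"
  shows "v \<le> v'"
proof -
  obtain f r1 r0 where via: "rep_via f r1 r0 B t v" using B unfolding rep_def by blast
  then have f: "computable_in {} f" "\<And>b. b \<in> B \<longleftrightarrow> f b \<in> U"
    and r1: "computable_in {} r1" "\<And>n. r1 n \<in> B"
    and r0: "computable_in {} r0" "\<And>n. r0 n \<notin> B"
    unfolding rep_via_def by blast+
  define \<kappa> where "\<kappa> b = \<beta> t (f b)" for b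
  have \<kappa>: "computable_in {} \<kappa>" "classes_of_size \<kappa> v"
    using via computable_in_comp[OF computable_\<beta>] unfolding \<kappa>_def rep_via_def by blast+
  obtain f' r1' r0' where via': "rep_via f' r1' r0' B' t v'" using B' unfolding rep_def by blast
  then have f': "computable_in {} f'" "\<And>b. b \<in> B' \<longleftrightarrow> f' b \<in> U"
    unfolding rep_via_def by blast+
  obtain g where g: "computable_in {} g" "\<And>b. b \<in> B \<longleftrightarrow> g b \<in> B'" "inj g"
    using \<open>B \<le>\<^sub>1 B'\<close> unfolding one_le_def many_one_reduction_def computable_def by blast
  \<comment> \<open>For undecided \<open>x\<close>, \<open>e j x\<close> is the point of rank
    \<open>j\<close> among those that \<open>f\<close> sends into the class of \<open>x\<close>, so
    it lies in \<open>B\<close> iff \<open>x\<close> lies in \<open>U\<close>.\<close>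
  define e where "e j x = (if \<beta> t x \<noteq> 0 then class_nth \<kappa> v (\<beta> t x) j
    else if A t x then r1 x else r0 x)" for j x
  have "\<exists>T. \<forall>x. \<beta> T (f' (g (e j x))) = \<beta> T x" if "j < v" for j
  proof (rule rigid)
    have "computable_in {} (e j)"
      unfolding e_def
      by (intro computable_in_if computable_intros decidable_A r1(1) r0(1) computable_\<beta>
          computable_in_comp2[OF computable_in_class_nth[OF \<kappa>]])
    then show "computable_in {} (\<lambda>x. f' (g (e j x)))"
      by (intro computable_in_comp[OF f'(1)] computable_in_comp[OF g(1)])
    show "x \<in> U \<longleftrightarrow> f' (g (e j x)) \<in> U" for x
    proof (cases "\<beta> t x = 0")
      case True
      then show ?thesis
        using decided[of t x] r1(2) r0(2) unfolding f'(2)[symmetric] g(2)[symmetric]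
        by (simp add: e_def)
    next
      case False
      then have "\<beta> t (f (e j x)) = \<beta> t x"
        using class_nth(1)[OF \<kappa>(2) False that] unfolding e_def \<kappa>_def by simp
      then show ?thesis
        using False unfolding f'(2)[symmetric] g(2)[symmetric] f(2) by (metis homogeneous)
    qed
  qed
  then obtain T where T: "\<And>j x. j < v \<Longrightarrow> \<beta> (T j) (f' (g (e j x))) = \<beta> (T j) x" by metis
  \<comment> \<open>The maximum over the finitely many ranks gives one stage late enough for all the
    self-reductions.\<close>
  define n where "n = Max (T ` {..<v})"
  have late: "\<beta> (t + n) (f' (g (e j x))) = \<beta> (t + n) x" if "j < v" for j x
  proof -
    have "T j \<le> t + n" unfolding n_def using that by (intro trans_le_add2 Max_ge) auto
    from rigid_mono[OF this, of "\<lambda>x. f' (g (e j x))"] T[OF that] show ?thesis by blast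
  qed
  \<comment> \<open>Such a point \<open>b\<close> is recovered as \<open>e j (f b)\<close> with
    \<open>j\<close> its own rank, so the preceding fact applies to it.\<close>
  have preserve: "\<beta> (t + n) (f' (g b)) = \<beta> (t + n) (f b)" if "\<beta> (t + n) (f b) \<noteq> 0" for b
  proof -
    have "\<kappa> b \<noteq> 0" unfolding \<kappa>_def using decided_mono[of t "t + n" "f b"] that by auto
    then have "e (rank \<kappa> b) (f b) = b"
      using class_nth_rank[OF \<kappa>(2)] unfolding e_def \<kappa>_def by simp
    then show ?thesis using late[OF rank_less[OF \<kappa>(2) \<open>\<kappa> b \<noteq> 0\<close>], of "f b"] by simp
  qed
  have c: "card {b. \<beta> (t + n) (f b) = Suc 0} = v * 2 ^ n"
    using rep_via_add[OF via, of n] unfolding rep_via_def classes_of_size_def by blast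
  have c': "finite {b. \<beta> (t + n) (f' b) = Suc 0}" "card {b. \<beta> (t + n) (f' b) = Suc 0} = v' * 2 ^ n"
    using rep_via_add[OF via', of n] unfolding rep_via_def classes_of_size_def by blast+
  have "card {b. \<beta> (t + n) (f b) = Suc 0} \<le> card {b. \<beta> (t + n) (f' b) = Suc 0}"
    by (rule card_inj_on_le[of g]) (use preserve c'(1) inj_on_subset[OF g(3)] in auto)
  then show ?thesis unfolding c c' by simp
qed

lemma infinite_range_if_finite_fibres:
  assumes "\<And>y. finite (g -` {y})" "inj (h :: nat \<Rightarrow> nat)"
  shows "infinite (range (\<lambda>n. g (h n)))"
proof
  assume "finite (range (\<lambda>n. g (h n)))"
  then have "finite (\<Union>y\<in>range (\<lambda>n. g (h n)). g -` {y})" using assms(1) by blast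
  moreover have "range h \<subseteq> (\<Union>y\<in>range (\<lambda>n. g (h n)). g -` {y})" by auto
  ultimately have "finite (range h)" by (rule rev_finite_subset)
  then show False using range_inj_infinite[OF assms(2)] by blast
qed

text \<open>\<open>count\<close> makes the number of preimages under \<open>f\<close> constant.
  Applying \<open>f\<close> after \<open>g\<close> is a self-reduction of \<open>U\<close>, so
  rigidity makes it preserve colours, which gives both positivity of the count and the padding of
  \<open>B\<close>.\<close>

lemma rep_if_bfo_equiv:
  assumes "B \<equiv>\<^sub>b\<^sub>f\<^sub>o U"
  shows "\<exists>t v. 1 \<le> v \<and> rep B t v"
proof -
  obtain f k where f: "computable_in {} f" "\<And>b. b \<in> B \<longleftrightarrow> f b \<in> U"
    "\<And>y. finite (f -` {y}) \<and> card (f -` {y}) \<le> k"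
    using assms unfolding bfo_equiv_def bfo_le_def many_one_reduction_def bounded_finite_one_def
      computable_def by blast
  obtain g where g: "computable_in {} g" "\<And>x. x \<in> U \<longleftrightarrow> g x \<in> B" "\<And>y. finite (g -` {y})"
    using assms unfolding bfo_equiv_def bfo_le_def many_one_reduction_def bounded_finite_one_def
      computable_def by blast
  obtain s u where su: "classes_of_size (\<lambda>b. \<beta> s (f b)) u"
    using count[OF f(1,3)] unfolding classes_of_size_def by blast
  obtain s' where s': "\<forall>x. \<beta> s' (f (g x)) = \<beta> s' x"
    using rigid[OF computable_in_comp[OF f(1) g(1)]] f(2) g(2) by blast
  define t where "t = s + s'"
  have fg: "\<beta> t (f (g x)) = \<beta> t x" for x
    using rigid_mono[OF _ s', of t] unfolding t_def by auto
  have v: "classes_of_size (\<lambda>b. \<beta> t (f b)) (u * 2 ^ s')"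
    unfolding t_def using classes_of_size_add[OF su] .
  \<comment> \<open>Through \<open>g\<close>, every class contains the image under \<open>f\<close>
    of some point, so the count is not 0.\<close>
  obtain x where "\<beta> t x = Suc 0" using class_nonempty by blast
  then have "g x \<in> {b. \<beta> t (f b) = Suc 0}" using fg by simp
  then have "card {b. \<beta> t (f b) = Suc 0} \<noteq> 0"
    using v unfolding classes_of_size_def by (metis card_0_eq empty_iff)
  then have "1 \<le> u * 2 ^ s'" using v unfolding classes_of_size_def by (metis less_one not_le)
  \<comment> \<open>The padding of \<open>U\<close> is carried to \<open>B\<close> by
    \<open>g\<close>; finite fibres keep its image infinite.\<close>
  have "computable_in {} (\<lambda>n. g (3 * n + 1))" "computable_in {} (\<lambda>n. g (3 * n + 2))"
    by (intro computable_in_comp[OF g(1)] computable_intros)+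
  moreover have "infinite (range (\<lambda>n. g (3 * n + 1)))" "infinite (range (\<lambda>n. g (3 * n + 2)))"
    by (intro infinite_range_if_finite_fibres g(3) injI, simp)+
  ultimately obtain r1 r0 where
    r1: "computable_in {} r1" "inj r1" "range r1 \<subseteq> range (\<lambda>n. g (3 * n + 1))" and
    r0: "computable_in {} r0" "inj r0" "range r0 \<subseteq> range (\<lambda>n. g (3 * n + 2))"
    using computable_injection_into_infinite_range by metis
  have "r1 n \<in> B \<and> \<beta> t (f (r1 n)) = 0" for n
  proof -
    obtain m where "r1 n = g (3 * m + 1)" using r1(3) by blast
    then show ?thesis using padding_in fg g(2) by metis
  qed
  moreover have "r0 n \<notin> B \<and> \<beta> t (f (r0 n)) = 0" for n
  proof -
    obtain m where "r0 n = g (3 * m + 2)" using r0(3) by blast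
    then show ?thesis using padding_out fg g(2) by metis
  qed
  ultimately have "rep_via f r1 r0 B t (u * 2 ^ s')"
    unfolding rep_via_def using f v r1 r0 by blast
  then show ?thesis using \<open>1 \<le> u * 2 ^ s'\<close> unfolding rep_def by blast
qed

text \<open>Meant for functions defined by two cases: \<open>S y\<close> covers the preimages that
  come from a class of bounded size, and \<open>r y\<close> is the single further one that an
  injective case can contribute.\<close>

lemma bounded_finite_oneI:
  assumes "\<And>y. finite (S y)" "\<And>y. card (S y) \<le> k" "\<And>y. f -` {y} \<subseteq> insert (r y) (S y)"
  shows "bounded_finite_one f"
  unfolding bounded_finite_one_def
proof (intro exI[of _ "Suc k"] conjI allI)
  fix y
  have fin: "finite (insert (r y) (S y))" using assms(1) by simp
  show "finite (f -` {y})" using finite_subset[OF assms(3) fin] .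
  have "card (f -` {y}) \<le> card (insert (r y) (S y))" by (rule card_mono[OF fin assms(3)])
  also have "\<dots> \<le> Suc (card (S y))" by (simp add: assms(1) card_insert_if)
  finally show "card (f -` {y}) \<le> Suc k" using assms(2)[of y] by simp
qed simp

text \<open>\<open>B\<close> has \<open>v\<close> copies of one representative from each class of
  stage \<open>t\<close>, together with the padding of \<open>U\<close>.\<close>

lemma rep_exists:
  assumes "1 \<le> v"
  shows "\<exists>B. B \<equiv>\<^sub>b\<^sub>f\<^sub>o U \<and> rep B t v"
proof -
  define p where "p i = (LEAST x. \<beta> t x = Suc i)" for i
  have p: "\<beta> t (p i) = Suc i" for i unfolding p_def by (rule LeastI_ex[OF class_nonempty])
  have comp_p: "computable_in {} p"
    unfolding p_def
    by (intro computable_in_Least class_nonempty computable_intros computable_in_comp[OF computable_\<beta>])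
  \<comment> \<open>The multiples of 3 are cut into blocks of \<open>v\<close>, and block
    \<open>i\<close> is sent to the representative \<open>p i\<close>; the other residues are
    padding and stay fixed.\<close>
  define f where "f b = (if b mod 3 = 0 then p (b div 3 div v) else b)" for b
  define B where "B = f -` U"
  have comp_f: "computable_in {} f"
    unfolding f_def using assms
    by (intro computable_in_if decidable_in_eq computable_in_comp[OF comp_p] computable_in_div
        computable_in_mod computable_in_const computable_in_id) auto
  have undecided: "\<beta> t (f b) = 0" if "b mod 3 \<noteq> 0" for b
  proof -
    have "b = 3 * (b div 3) + 1 \<or> b = 3 * (b div 3) + 2" using that by presburger
    then show ?thesis using that padding_in(1)[of t "b div 3"] padding_out(1)[of t "b div 3"]
      unfolding f_def by metis
  qed
  have \<kappa>: "\<beta> t (f b) = Suc i \<longleftrightarrow> b mod 3 = 0 \<and> b div 3 div v = i" for b i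
    using undecided[of b] p by (cases "b mod 3 = 0") (auto simp: f_def)
  have fibre: "{b. \<beta> t (f b) = Suc i} = (\<lambda>y. 3 * y) ` {i * v..<i * v + v}" for i
  proof -
    have "y div v = i \<longleftrightarrow> i * v \<le> y \<and> y < i * v + v" for y
    proof -
      have "y div v = i \<longleftrightarrow> i \<le> y div v \<and> y div v < Suc i" by auto
      also have "\<dots> \<longleftrightarrow> i * v \<le> y \<and> y < i * v + v"
        using assms by (simp add: less_eq_div_iff_mult_less_eq div_less_iff_less_mult add.commute)
      finally show ?thesis .
    qed
    moreover have "b mod 3 = 0 \<longleftrightarrow> (\<exists>y. b = 3 * y)" for b :: nat
      by presburger
    ultimately show ?thesis unfolding \<kappa> by auto
  qed
  have size: "classes_of_size (\<lambda>b. \<beta> t (f b)) v"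
    unfolding classes_of_size_def fibre by (auto simp: card_image inj_on_def)
  have "rep_via f (\<lambda>n. 3 * n + 1) (\<lambda>n. 3 * n + 2) B t v"
    unfolding rep_via_def B_def using comp_f size padding_in(2) padding_out(2) undecided
    by (auto intro!: computable_intros simp: f_def inj_def mod_Suc)
  moreover have "B \<le>\<^sub>b\<^sub>f\<^sub>o U"
  proof -
    have "bounded_finite_one f"
    proof (rule bounded_finite_oneI)
      let ?S = "\<lambda>y. if \<beta> t y = 0 then {} else {b. \<beta> t (f b) = \<beta> t y}"
      show "finite (?S y)" "card (?S y) \<le> v" for y
        using classes_of_sizeD[OF size] by simp_all
      show "f -` {y} \<subseteq> insert y (?S y)" for y
      proof
        fix b assume "b \<in> f -` {y}"
        then have y: "f b = y" by simp
        show "b \<in> insert y (?S y)"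
        proof (cases "b mod 3 = 0")
          case True
          then have "\<beta> t y \<noteq> 0" using p y unfolding f_def by auto
          then show ?thesis using y by simp
        next
          case False
          then show ?thesis using y unfolding f_def by simp
        qed
      qed
    qed
    then show ?thesis
      unfolding bfo_le_def many_one_reduction_def computable_def B_def using comp_f by auto
  qed
  moreover have "U \<le>\<^sub>b\<^sub>f\<^sub>o B"
  proof -
    \<comment> \<open>Each class collapses to the first point of its block, the colour being one
      more than the block number; decided points go injectively to padding.\<close>
    define g where "g x = (if \<beta> t x \<noteq> 0 then 3 * (v * (\<beta> t x - 1))
      else if A t x then 3 * x + 1 else 3 * x + 2)" for x
    have "computable_in {} g"
      unfolding g_def by (intro computable_in_if computable_intros computable_\<beta> decidable_A)
    moreover have "x \<in> U \<longleftrightarrow> g x \<in> B" for x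
    proof (cases "\<beta> t x = 0")
      case True
      then show ?thesis
        using decided[of t x] padding_in(2)[of x] padding_out(2)[of x]
        by (auto simp: g_def B_def f_def mod_Suc)
    next
      case False
      then have "\<beta> t (f (g x)) = \<beta> t x" using assms p by (simp add: g_def f_def)
      then show ?thesis using False homogeneous unfolding B_def by (metis vimage_eq)
    qed
    moreover have "bounded_finite_one g"
    proof (rule bounded_finite_oneI)
      \<comment> \<open>Dividing by 3 and by \<open>v\<close> recovers the block;
        \<open>y div 3\<close> recovers the only possible decided preimage.\<close>
      let ?S = "\<lambda>y. {x. \<beta> t x = Suc (y div 3 div v)}"
      show "finite (?S y)" "card (?S y) \<le> 2 ^ t" for y
        using class_size[of t] unfolding classes_of_size_def by simp_all
      show "g -` {y} \<subseteq> insert (y div 3) (?S y)" for y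
        using assms by (auto simp: g_def split: if_splits)
    qed
    ultimately show ?thesis unfolding bfo_le_def many_one_reduction_def computable_def by blast
  qed
  ultimately show ?thesis unfolding bfo_equiv_def rep_def by blast
qed

end

section \<open>Order isomorphisms\<close>

text \<open>A relation may stand for the isomorphism: since it respects the orders, antisymmetry
  makes it single-valued and injective.\<close>

lemma order_isomorphicI:
  assumes total: "\<And>x. x \<in> X \<Longrightarrow> \<exists>y\<in>Y. R x y" and onto: "\<And>y. y \<in> Y \<Longrightarrow> \<exists>x\<in>X. R x y"
    and iff: "\<And>x y x' y'. x \<in> X \<Longrightarrow> x' \<in> X \<Longrightarrow> y \<in> Y \<Longrightarrow> y' \<in> Y \<Longrightarrow> R x y \<Longrightarrow> R x' y' \<Longrightarrow>
      leX x x' \<longleftrightarrow> leY y y'"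
    and X: "\<And>x. x \<in> X \<Longrightarrow> leX x x" "\<And>x x'. x \<in> X \<Longrightarrow> x' \<in> X \<Longrightarrow> leX x x' \<Longrightarrow> leX x' x \<Longrightarrow> x = x'"
    and Y: "\<And>y. y \<in> Y \<Longrightarrow> leY y y" "\<And>y y'. y \<in> Y \<Longrightarrow> y' \<in> Y \<Longrightarrow> leY y y' \<Longrightarrow> leY y' y \<Longrightarrow> y = y'"
  shows "order_isomorphic X leX Y leY"
proof -
  obtain h where h: "\<And>x. x \<in> X \<Longrightarrow> h x \<in> Y" "\<And>x. x \<in> X \<Longrightarrow> R x (h x)"
    using total by metis
  have h_iff: "leX x x' \<longleftrightarrow> leY (h x) (h x')" if "x \<in> X" "x' \<in> X" for x x'
    using iff h that by blast
  have "bij_betw h X Y"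
  proof (rule bij_betw_imageI)
    show "inj_on h X" by (rule inj_onI) (use h_iff h(1) X(2) Y(1) in metis)
    have "y \<in> h ` X" if y: "y \<in> Y" for y
    proof -
      obtain x where x: "x \<in> X" "R x y" using onto[OF y] by blast
      have "leY (h x) y" "leY y (h x)"
        using iff[OF x(1) x(1) h(1)[OF x(1)] y h(2)[OF x(1)] x(2)]
          iff[OF x(1) x(1) y h(1)[OF x(1)] x(2) h(2)[OF x(1)]] X(1)[OF x(1)] by blast+
      then have "h x = y" using Y(2) h(1)[OF x(1)] y by blast
      then show ?thesis using x(1) by blast
    qed
    then show "h ` X = Y" using h(1) by blast
  qed
  then show ?thesis unfolding order_isomorphic_def using h_iff by blast
qed

section \<open>Cantor's theorem on countable dense orders\<close>

definition dense_unbounded :: "'a::linorder set \<Rightarrow> bool" where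
  "dense_unbounded Y \<longleftrightarrow> Y \<noteq> {} \<and> (\<forall>x\<in>Y. \<forall>y\<in>Y. x < y \<longrightarrow> (\<exists>z\<in>Y. x < z \<and> z < y)) \<and>
    (\<forall>x\<in>Y. \<exists>y\<in>Y. y < x) \<and> (\<forall>x\<in>Y. \<exists>y\<in>Y. x < y)"

lemma dense_unbounded_between:
  assumes Y: "dense_unbounded Y" and fin: "finite L" "finite R" "L \<subseteq> Y" "R \<subseteq> Y"
    and less: "\<And>l r. l \<in> L \<Longrightarrow> r \<in> R \<Longrightarrow> l < r"
  obtains y where "y \<in> Y" "\<And>l. l \<in> L \<Longrightarrow> l < y" "\<And>r. r \<in> R \<Longrightarrow> y < r"
proof -
  have L: "Max L \<in> L \<and> Max L \<in> Y \<and> (\<forall>l\<in>L. l \<le> Max L)" if "L \<noteq> {}"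
    using Max_in[OF fin(1) that] fin by auto
  have R: "Min R \<in> R \<and> Min R \<in> Y \<and> (\<forall>r\<in>R. Min R \<le> r)" if "R \<noteq> {}"
    using Min_in[OF fin(2) that] fin by auto
  consider "L = {}" "R = {}" | "L \<noteq> {}" "R = {}" | "L = {}" "R \<noteq> {}" | "L \<noteq> {}" "R \<noteq> {}" by blast
  then have "\<exists>y\<in>Y. (\<forall>l\<in>L. l < y) \<and> (\<forall>r\<in>R. y < r)"
  proof cases
    case 1
    then show ?thesis using Y unfolding dense_unbounded_def by blast
  next
    case 2
    then obtain y where "y \<in> Y" "Max L < y" using Y L unfolding dense_unbounded_def by blast
    then show ?thesis using 2 L by (metis empty_iff le_less_trans)
  next
    case 3
    then obtain y where "y \<in> Y" "y < Min R" using Y R unfolding dense_unbounded_def by blast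
    then show ?thesis using 3 R by (metis empty_iff less_le_trans)
  next
    case 4
    then obtain y where "y \<in> Y" "Max L < y" "y < Min R"
      using Y L R less unfolding dense_unbounded_def by blast
    then show ?thesis using 4 L R by (metis le_less_trans less_le_trans)
  qed
  then show ?thesis using that by blast
qed

definition partial_iso :: "'a::linorder set \<Rightarrow> 'b::linorder set \<Rightarrow> ('a \<times> 'b) set \<Rightarrow> bool" where
  "partial_iso X Y F \<longleftrightarrow> finite F \<and> F \<subseteq> X \<times> Y \<and>
    (\<forall>a b a' b'. (a, b) \<in> F \<longrightarrow> (a', b') \<in> F \<longrightarrow> (a \<le> a' \<longleftrightarrow> b \<le> b'))"

text \<open>The images of the points below and above \<open>x\<close> form a finite cut of
  \<open>Y\<close>, and any element in the gap can be the image of \<open>x\<close>.\<close>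

lemma partial_iso_extend:
  assumes F: "partial_iso X Y F" and Y: "dense_unbounded Y" and x: "x \<in> X"
  shows "\<exists>F'. F \<subseteq> F' \<and> partial_iso X Y F' \<and> x \<in> Domain F'"
proof (cases "x \<in> Domain F")
  case False
  define L where "L = {b. \<exists>a. (a, b) \<in> F \<and> a < x}"
  define R where "R = {b. \<exists>a. (a, b) \<in> F \<and> x < a}"
  have sub: "L \<subseteq> snd ` F" "R \<subseteq> snd ` F" unfolding L_def R_def by force+
  have fin: "finite (snd ` F)" "snd ` F \<subseteq> Y" using F unfolding partial_iso_def by auto
  have iff: "a \<le> a' \<longleftrightarrow> b \<le> b'" if "(a, b) \<in> F" "(a', b') \<in> F" for a b a' b'
    using F that unfolding partial_iso_def by blast
  have less: "l < r" if "l \<in> L" "r \<in> R" for l r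
  proof -
    obtain a a' where "(a, l) \<in> F" "a < x" "(a', r) \<in> F" "x < a'"
      using \<open>l \<in> L\<close> \<open>r \<in> R\<close> unfolding L_def R_def by blast
    then show ?thesis using iff[of a' r a l] by auto
  qed
  have "finite L" "finite R" "L \<subseteq> Y" "R \<subseteq> Y"
    using sub fin by (auto intro: finite_subset)
  from dense_unbounded_between[OF Y this less]
  obtain y where y: "y \<in> Y" "\<And>l. l \<in> L \<Longrightarrow> l < y" "\<And>r. r \<in> R \<Longrightarrow> y < r" by blast
  have "(a \<le> x \<longleftrightarrow> b \<le> y) \<and> (x \<le> a \<longleftrightarrow> y \<le> b)" if "(a, b) \<in> F" for a b
  proof -
    have "a \<noteq> x" using False that by blast
    then consider "a < x" | "x < a" by (meson linorder_neq_iff)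
    then show ?thesis
    proof cases
      case 1
      then have "b < y" using y(2) that unfolding L_def by blast
      then show ?thesis using 1 by auto
    next
      case 2
      then have "y < b" using y(3) that unfolding R_def by blast
      then show ?thesis using 2 by auto
    qed
  qed
  then have "partial_iso X Y (insert (x, y) F)"
    using F x y(1) unfolding partial_iso_def by auto
  then show ?thesis by blast
qed (use F in blast)

lemma partial_iso_converse: "partial_iso X Y F \<Longrightarrow> partial_iso Y X (F\<inverse>)"
  unfolding partial_iso_def by auto

text \<open>Back and forth: step \<open>n\<close> adds the \<open>n\<close>-th point of
  \<open>X\<close> to the domain and, by extending the converse, the \<open>n\<close>-th point of
  \<open>Y\<close> to the range.\<close>

theorem countable_dense_unbounded_order_isomorphic:
  fixes X :: "'a::linorder set" and Y :: "'b::linorder set"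
  assumes X: "countable X" "dense_unbounded X" and Y: "countable Y" "dense_unbounded Y"
  shows "order_isomorphic X (\<le>) Y (\<le>)"
proof -
  have ne: "X \<noteq> {}" "Y \<noteq> {}" using X Y unfolding dense_unbounded_def by auto
  have "\<exists>F. \<forall>n. partial_iso X Y (F n) \<and> (F n \<subseteq> F (Suc n) \<and>
      from_nat_into X n \<in> Domain (F (Suc n)) \<and> from_nat_into Y n \<in> Range (F (Suc n)))"
  proof (rule dependent_nat_choice)
    show "\<exists>F. partial_iso X Y F" by (rule exI[of _ "{}"]) (simp add: partial_iso_def)
    fix F n assume F: "partial_iso X Y F"
    obtain F1 where F1: "F \<subseteq> F1" "partial_iso X Y F1" "from_nat_into X n \<in> Domain F1"
      using partial_iso_extend[OF F Y(2) from_nat_into[OF ne(1)]] by blast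
    obtain F2 where F2: "F1\<inverse> \<subseteq> F2" "partial_iso Y X F2" "from_nat_into Y n \<in> Domain F2"
      using partial_iso_extend[OF partial_iso_converse[OF F1(2)] X(2) from_nat_into[OF ne(2)]] by blast
    have "F \<subseteq> F2\<inverse>" "from_nat_into X n \<in> Domain (F2\<inverse>)" using F1 F2(1) by auto
    then show "\<exists>F'. partial_iso X Y F' \<and> (F \<subseteq> F' \<and>
        from_nat_into X n \<in> Domain F' \<and> from_nat_into Y n \<in> Range F')"
      using partial_iso_converse[OF F2(2)] F2(3) by auto
  qed
  then obtain F where F: "\<And>n. partial_iso X Y (F n)" "\<And>n. F n \<subseteq> F (Suc n)"
    "\<And>n. from_nat_into X n \<in> Domain (F (Suc n))" "\<And>n. from_nat_into Y n \<in> Range (F (Suc n))"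
    by blast
  have mono: "F m \<subseteq> F n" if "m \<le> n" for m n using lift_Suc_mono_le[of F] F(2) that by blast
  have sub: "F n \<subseteq> X \<times> Y" for n using F(1) unfolding partial_iso_def by blast
  show ?thesis
  proof (rule order_isomorphicI[where R = "\<lambda>x y. (x, y) \<in> (\<Union>n. F n)"])
    fix x assume "x \<in> X"
    then obtain n where "x = from_nat_into X n" using from_nat_into_surj[OF X(1)] by metis
    then show "\<exists>y\<in>Y. (x, y) \<in> (\<Union>n. F n)" using F(3)[of n] sub by blast
  next
    fix y assume "y \<in> Y"
    then obtain n where "y = from_nat_into Y n" using from_nat_into_surj[OF Y(1)] by metis
    then show "\<exists>x\<in>X. (x, y) \<in> (\<Union>n. F n)" using F(4)[of n] sub by blast
  next
    fix x y x' y' assume "(x, y) \<in> (\<Union>n. F n)" "(x', y') \<in> (\<Union>n. F n)"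
    then obtain m n where "(x, y) \<in> F m" "(x', y') \<in> F n" by blast
    then have "(x, y) \<in> F (max m n)" "(x', y') \<in> F (max m n)"
      using mono[of m "max m n"] mono[of n "max m n"] by auto
    then show "x \<le> x' \<longleftrightarrow> y \<le> y'" using F(1) unfolding partial_iso_def by blast
  qed auto
qed

lemma order_isomorphic_imp_countable_dense:
  fixes Y :: "'b::linorder set"
  assumes iso: "order_isomorphic X le Y (\<le>)" and Y: "countable Y" "dense_unbounded Y"
  shows "countable_dense_linear_order_without_endpoints X le"
proof -
  obtain h where h: "bij_betw h X Y" and le: "\<And>x y. x \<in> X \<Longrightarrow> y \<in> X \<Longrightarrow> le x y \<longleftrightarrow> h x \<le> h y"
    using iso unfolding order_isomorphic_def by blast
  have eq: "x = y \<longleftrightarrow> h x = h y" if "x \<in> X" "y \<in> X" for x y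
    using h that unfolding bij_betw_def inj_on_def by blast
  have less: "le x y \<and> x \<noteq> y \<longleftrightarrow> h x < h y" if "x \<in> X" "y \<in> X" for x y
    using le eq that by (metis order.strict_iff_order)
  have hX: "h x \<in> Y" if "x \<in> X" for x using h that unfolding bij_betw_def by blast
  have hY: "\<exists>x\<in>X. h x = y" if "y \<in> Y" for y using h that unfolding bij_betw_def by blast
  have "linear_order_on X (relation_of le X)"
    unfolding linear_order_on_def partial_order_on_def preorder_on_def relation_of_def
    using le eq by (auto simp: refl_on_def total_on_def antisym_def trans_def)
  moreover have "countable X" using h Y(1) unfolding bij_betw_def by (metis countable_image_inj_on)
  moreover have "X \<noteq> {}" using Y(2) hY unfolding dense_unbounded_def by blast
  moreover have "\<exists>z\<in>X. le x z \<and> x \<noteq> z \<and> le z y \<and> z \<noteq> y" if "x \<in> X" "y \<in> X" "le x y \<and> x \<noteq> y" for x y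
  proof -
    have "h x < h y" using less that by blast
    then obtain u where u: "u \<in> Y" "h x < u" "u < h y"
      using Y(2) hX[OF \<open>x \<in> X\<close>] hX[OF \<open>y \<in> X\<close>] unfolding dense_unbounded_def by blast
    obtain z where z: "z \<in> X" "h z = u" using hY[OF u(1)] by blast
    show ?thesis
      using less[OF \<open>x \<in> X\<close> z(1)] less[OF z(1) \<open>y \<in> X\<close>] u z by blast
  qed
  moreover have "\<exists>y\<in>X. le y x \<and> y \<noteq> x" if x: "x \<in> X" for x
  proof -
    obtain u where u: "u \<in> Y" "u < h x" using Y(2) hX[OF x] unfolding dense_unbounded_def by blast
    obtain z where z: "z \<in> X" "h z = u" using hY[OF u(1)] by blast
    show ?thesis using less[OF z(1) x] u z by blast
  qed
  moreover have "\<exists>y\<in>X. le x y \<and> x \<noteq> y" if x: "x \<in> X" for x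
  proof -
    obtain u where u: "u \<in> Y" "h x < u" using Y(2) hX[OF x] unfolding dense_unbounded_def by blast
    obtain z where z: "z \<in> X" "h z = u" using hY[OF u(1)] by blast
    show ?thesis using less[OF x z(1)] u z by blast
  qed
  ultimately show ?thesis unfolding countable_dense_linear_order_without_endpoints_def by blast
qed

section \<open>The positive dyadic rationals as a dense order\<close>

lemma positive_dyadics_add:
  assumes "a \<in> positive_dyadics" "b \<in> positive_dyadics"
  shows "a + b \<in> positive_dyadics"
proof -
  obtain m n m' n' where ab: "a = of_nat m / 2 ^ n" "b = of_nat m' / 2 ^ n'" "m \<ge> 1"
    using assms unfolding positive_dyadics_def by blast
  have "a + b = of_nat (m * 2 ^ n' + m' * 2 ^ n) / 2 ^ (n + n')"
    unfolding ab by (simp add: field_simps power_add)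
  moreover have "m * 2 ^ n' + m' * 2 ^ n \<ge> 1" using ab(3) by (simp add: Suc_le_eq)
  ultimately show ?thesis unfolding positive_dyadics_def by blast
qed

lemma positive_dyadics_half:
  assumes "a \<in> positive_dyadics"
  shows "a / 2 \<in> positive_dyadics"
proof -
  obtain m n where a: "a = of_nat m / 2 ^ n" "m \<ge> 1"
    using assms unfolding positive_dyadics_def by blast
  then have "a / 2 = of_nat m / 2 ^ Suc n" by simp
  then show ?thesis using a(2) unfolding positive_dyadics_def by blast
qed

lemma positive_dyadics_pos: "a \<in> positive_dyadics \<Longrightarrow> 0 < a"
  unfolding positive_dyadics_def by auto

lemma dense_unbounded_positive_dyadics: "dense_unbounded positive_dyadics"
  unfolding dense_unbounded_def
proof (intro conjI ballI impI)
  have "1 = of_nat 1 / (2 ^ 0 :: rat)" by simp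
  then have "1 \<in> positive_dyadics" unfolding positive_dyadics_def by blast
  then show "positive_dyadics \<noteq> {}" by blast
next
  fix x y :: rat
  assume xy: "x \<in> positive_dyadics" "y \<in> positive_dyadics" "x < y"
  show "\<exists>z\<in>positive_dyadics. x < z \<and> z < y"
    by (rule bexI[OF _ positive_dyadics_half[OF positive_dyadics_add[OF xy(1,2)]]])
      (use xy(3) in auto)
next
  fix x :: rat assume x: "x \<in> positive_dyadics"
  show "\<exists>y\<in>positive_dyadics. y < x"
    by (rule bexI[OF _ positive_dyadics_half[OF x]]) (use positive_dyadics_pos[OF x] in auto)
  show "\<exists>y\<in>positive_dyadics. x < y"
    by (rule bexI[OF _ positive_dyadics_add[OF x x]]) (use positive_dyadics_pos[OF x] in auto)
qed

lemma dense_unbounded_UNIV: "dense_unbounded (UNIV :: rat set)"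
  unfolding dense_unbounded_def using dense lt_ex gt_ex by auto

section \<open>The one-one degrees inside the bounded finite-one degree\<close>

lemma one_degree_eq: "A \<equiv>\<^sub>1 B \<Longrightarrow> one_degree A = one_degree B"
  unfolding one_degree_def one_equiv_def using one_le_trans by blast

context tower
begin

definition has_value :: "nat set \<Rightarrow> rat \<Rightarrow> bool" where
  "has_value B d \<longleftrightarrow> (\<exists>t v. 1 \<le> v \<and> rep B t v \<and> d = of_nat v / 2 ^ t)"

text \<open>At the common stage \<open>t + t'\<close>, reducibility is comparison of class sizes,
  which is comparison of the two fractions after cross-multiplication.\<close>

lemma one_le_iff_value_le:
  assumes "has_value B d" "has_value B' d'"
  shows "B \<le>\<^sub>1 B' \<longleftrightarrow> d \<le> d'"
proof -
  obtain t v t' v' where B: "rep B t v" "d = of_nat v / 2 ^ t"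
    and B': "rep B' t' v'" "d' = of_nat v' / 2 ^ t'"
    using assms unfolding has_value_def by blast
  have "rep B (t + t') (v * 2 ^ t')" "rep B' (t + t') (v' * 2 ^ t)"
    using rep_add[OF B(1), of t'] rep_add[OF B'(1), of t] by (simp_all add: add.commute)
  then have "B \<le>\<^sub>1 B' \<longleftrightarrow> v * 2 ^ t' \<le> v' * 2 ^ t" using rep_one_le one_le_rep by blast
  also have "\<dots> \<longleftrightarrow> (of_nat (v * 2 ^ t') :: rat) \<le> of_nat (v' * 2 ^ t)" by (simp only: of_nat_le_iff)
  also have "\<dots> \<longleftrightarrow> d \<le> d'" unfolding B B' by (simp add: field_simps)
  finally show ?thesis .
qed

lemma one_degrees_isomorphic:
  "order_isomorphic (one_degrees_in_bfo_degree U) one_degree_le positive_dyadics (\<le>)"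
proof (rule order_isomorphicI[where R = "\<lambda>D d. \<exists>B. D = one_degree B \<and> has_value B d"])
  fix D assume "D \<in> one_degrees_in_bfo_degree U"
  then obtain B where B: "D = one_degree B" "B \<equiv>\<^sub>b\<^sub>f\<^sub>o U" unfolding one_degrees_in_bfo_degree_def by blast
  obtain t v where "1 \<le> v" "rep B t v" using rep_if_bfo_equiv[OF B(2)] by blast
  then have "has_value B (of_nat v / 2 ^ t)" "of_nat v / 2 ^ t \<in> positive_dyadics"
    unfolding has_value_def positive_dyadics_def by blast+
  then show "\<exists>d\<in>positive_dyadics. \<exists>B. D = one_degree B \<and> has_value B d" using B(1) by blast
next
  fix d assume "d \<in> positive_dyadics"
  then obtain v t where "d = of_nat v / 2 ^ t" "1 \<le> v" unfolding positive_dyadics_def by blast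
  then show "\<exists>D\<in>one_degrees_in_bfo_degree U. \<exists>B. D = one_degree B \<and> has_value B d"
    using rep_exists[of v t] unfolding has_value_def one_degrees_in_bfo_degree_def by blast
next
  fix D d D' d'
  assume "\<exists>B. D = one_degree B \<and> has_value B d" "\<exists>B. D' = one_degree B \<and> has_value B d'"
  then show "one_degree_le D D' \<longleftrightarrow> d \<le> d'" using one_degree_le_iff one_le_iff_value_le by blast
next
  fix D assume "D \<in> one_degrees_in_bfo_degree U"
  then show "one_degree_le D D"
    unfolding one_degrees_in_bfo_degree_def using one_degree_le_iff one_le_refl by blast
next
  fix D E assume "D \<in> one_degrees_in_bfo_degree U" "E \<in> one_degrees_in_bfo_degree U"
    "one_degree_le D E" "one_degree_le E D"
  moreover from this obtain B C where "D = one_degree B" "E = one_degree C"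
    unfolding one_degrees_in_bfo_degree_def by blast
  ultimately have "B \<equiv>\<^sub>1 C" unfolding one_equiv_def by (simp add: one_degree_le_iff)
  then show "D = E" using \<open>D = one_degree B\<close> \<open>E = one_degree C\<close> one_degree_eq by simp
qed auto

end

theorem mainTheorem1:
  "\<exists>U :: nat set.
    \<not> computable_set U \<and>
    U \<le>\<^sub>T jump (jump {}) \<and>
    order_isomorphic (one_degrees_in_bfo_degree U) one_degree_le positive_dyadics (\<le>) \<and>
    order_isomorphic positive_dyadics (\<le>) (UNIV :: rat set) (\<le>) \<and>
    countable_dense_linear_order_without_endpoints (one_degrees_in_bfo_degree U) one_degree_le"
proof (intro exI conjI)
  interpret tower limit_set "\<lambda>t. colour (stage t)" "\<lambda>t. member (stage t)"
    by (rule tower_limit_set)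
  have countable: "countable (positive_dyadics :: rat set)" by (rule countableI_type)
  show "\<not> computable_set limit_set" by (rule not_computable)
  show "limit_set \<le>\<^sub>T jump (jump {})" by (rule turing_le_limit_set)
  show iso: "order_isomorphic (one_degrees_in_bfo_degree limit_set) one_degree_le positive_dyadics (\<le>)"
    by (rule one_degrees_isomorphic)
  show "order_isomorphic positive_dyadics (\<le>) (UNIV :: rat set) (\<le>)"
    by (intro countable_dense_unbounded_order_isomorphic countable dense_unbounded_positive_dyadics
        dense_unbounded_UNIV countableI_type)
  show "countable_dense_linear_order_without_endpoints
      (one_degrees_in_bfo_degree limit_set) one_degree_le"
    by (rule order_isomorphic_imp_countable_dense[OF iso countable dense_unbounded_positive_dyadics])
qed

end
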